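(* The (stabilizer free) weak Galerkin finite element scheme: find $u_h=\{u_0,u_b\}\in V_h$ satisfying $u_b=Q_bg$ on $\partial\Omega$ and $$(a\nabla_wu_h,\nabla_wv)_{\mathcal{T}_h}=(f,v_0)\qquad\forall v=\{v_0,v_b\}\in V_h^0,$$ has a unique solution.
   Context: Setting. $\Omega\subset\mathbb{R}^2$ is a (bounded) polygonal domain; $a$ is a symmetric $2\times2$ matrix-valued function on $\Omega$ with constants $\lambda_1,\lambda_2>0$ such that $\lambda_1\xi^t\xi\le \xi^t a\xi\le\lambda_2\xi^t\xi$ for all $\xi\in\mathbb{R}^2$. The data $f$ and $g$ are given functions on $\Omega$ and $\partial\Omega$ (e.g. $f\in L^2(\Omega)$, $g\in L^2(\partial\Omega)$); the model problem is $-\nabla\cdot(a\nabla u)=f$ in $\Omega$, $u=g$ on $\partial\Omega$. Mesh. $\mathcal{T}_h$ is a shape regular (conforming) partition of $\Omega$ into triangles. Write $(v,w)_{\mathcal{T}_h}=\sum_{T\in\mathcal{T}_h}\int_T vw\,d\mathbf{x}$. Spaces. Fix an integer $k\ge1$. $V_h$ is the set of pairs $v=\{v_0,v_b\}$ with $v_0|_T\in P_k(T)$ for each $T\in\mathcal{T}_h$ and $v_b|_e\in P_{k+1}(e)$ for each edge $e$ of the mesh ($v_b$ is single valued on each edge; $v_0$ is discontinuous across elements and $v_b$ is independent of the trace of $v_0$). $V_h^0=\{v\in V_h: v_b=0\text{ on }\partial\Omega\}$. Weak gradient. For $v=\{v_0,v_b\}\in V_h$, $\nabla_w v$ is defined on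 each $T$ as the element of $[P_{k+1}(T)]^2$ satisfying $(\nabla_w v,\mathbf{q})_T=-(v_0,\nabla\cdot\mathbf{q})_T+\langle v_b,\mathbf{q}\cdot\mathbf{n}\rangle_{\partial T}$ for all $\mathbf{q}\in[P_{k+1}(T)]^2$, with $\mathbf{n}$ the unit outward normal. $Q_b$ is the edge-wise $L^2$ projection onto $P_{k+1}(e)$. *)

theory Defs
  imports "HOL-Analysis.Analysis"
begin

type_synonym R2 = "real^2"

definition polygonal_domain :: "R2 set \<Rightarrow> bool" where
  "polygonal_domain \<Omega> \<longleftrightarrow>
     open \<Omega> \<and> connected \<Omega> \<and> bounded \<Omega> \<and> \<Omega> \<noteq> {} \<and>
     (\<exists>S. finite S \<and> frontier \<Omega> = (\<Union>(p, q)\<in>S. closed_segment p q))"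

definition edges :: "R2 set set \<Rightarrow> R2 set set" where
  "edges \<T> = {e. \<exists>T\<in>\<T>. e edge_of T}"

definition boundary_edges :: "R2 set \<Rightarrow> R2 set set \<Rightarrow> R2 set set" where
  "boundary_edges \<Omega> \<T> = {e \<in> edges \<T>. e \<subseteq> frontier \<Omega>}"

text \<open>
  Elements are closed nondegenerate triangles. The library predicate \<^const>\<open>triangulation\<close>
  contains finiteness and conformity (two elements meet in a common face, possibly empty).
  The last condition says that the mesh resolves the boundary. It follows from the others when
  \<open>\<Omega> = interior (closure \<Omega>)\<close> and only matters for domains with slits, where \<open>closure \<Omega>\<close> does
  not determine \<open>\<Omega>\<close>.
\<close>

definition triangular_mesh :: "R2 set \<Rightarrow> R2 set set \<Rightarrow> bool" where
  "triangular_mesh \<Omega> \<T> \<longleftrightarrow>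
     triangulation \<T> \<and> (\<forall>T\<in>\<T>. 2 simplex T) \<and> \<Union>\<T> = closure \<Omega> \<and>
     \<Union>(boundary_edges \<Omega> \<T>) = frontier \<Omega>"

definition inradius :: "R2 set \<Rightarrow> real" where
  "inradius T = Sup {r. \<exists>c. cball c r \<subseteq> T}"

definition shape_regular :: "real \<Rightarrow> R2 set set \<Rightarrow> bool" where
  "shape_regular \<sigma> \<T> \<longleftrightarrow> (\<forall>T\<in>\<T>. diameter T \<le> \<sigma> * inradius T)"

definition outward_normal :: "R2 set \<Rightarrow> R2 set \<Rightarrow> R2" where
  "outward_normal T e =
     (THE n. norm n = 1 \<and> (\<forall>x\<in>e. \<forall>y\<in>e. n \<bullet> (y - x) = 0) \<and> (\<forall>x\<in>e. \<forall>y\<in>T. n \<bullet> (y - x) \<le> 0))"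

text \<open>
  Integral over the segment \<open>e\<close> with respect to arc length. The endpoints are determined up to
  order, and the value does not depend on the order.
\<close>

definition edge_integral :: "R2 set \<Rightarrow> (R2 \<Rightarrow> real) \<Rightarrow> real" where
  "edge_integral e \<phi> =
     (let (p, q) = (SOME (p, q). e = closed_segment p q)
      in dist p q * (LINT t|lebesgue_on {0..1}. \<phi> (linepath p q t)))"

definition L2_on :: "'a::euclidean_space set \<Rightarrow> ('a \<Rightarrow> real) \<Rightarrow> bool" where
  "L2_on S f \<longleftrightarrow>
     f \<in> borel_measurable (lebesgue_on S) \<and> integrable (lebesgue_on S) (\<lambda>x. (f x)\<^sup>2)"

text \<open>
  Since \<open>frontier \<Omega>\<close> is a finite union of segments, membership in \<open>L\<^sup>2(\<partial>\<Omega>)\<close> can be tested on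
  segments contained in it.
\<close>

definition L2_on_boundary :: "R2 set \<Rightarrow> (R2 \<Rightarrow> real) \<Rightarrow> bool" where
  "L2_on_boundary \<Omega> g \<longleftrightarrow>
     (\<forall>p q. closed_segment p q \<subseteq> frontier \<Omega> \<longrightarrow> L2_on {0..1} (\<lambda>t. g (linepath p q t)))"

text \<open>
  \<open>Pk k S\<close>: polynomials of total degree at most \<open>k\<close>, as functions on \<open>S\<close>. They are extended by
  zero, so that two elements agree on \<open>S\<close> iff they are equal. For a segment \<open>S\<close> these are
  exactly the polynomials of degree at most \<open>k\<close> in the arc length parameter.
\<close>

definition Pk :: "nat \<Rightarrow> R2 set \<Rightarrow> (R2 \<Rightarrow> real) set" where
  "Pk k S =
     {p. \<exists>c :: nat \<Rightarrow> nat \<Rightarrow> real.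
        p = (\<lambda>x. if x \<in> S then \<Sum>i\<le>k. \<Sum>j\<le>k - i. c i j * (x $ 1) ^ i * (x $ 2) ^ j else 0)}"

definition Pvec :: "nat \<Rightarrow> R2 set \<Rightarrow> (R2 \<Rightarrow> R2) set" where
  "Pvec k S = {q. \<forall>i. (\<lambda>x. q x $ i) \<in> Pk k S}"

definition divergence :: "(R2 \<Rightarrow> R2) \<Rightarrow> R2 \<Rightarrow> real" where
  "divergence q x = trace (jacobian q (at x))"

text \<open>
  A weak function \<open>{v\<^sub>0, v\<^sub>b}\<close> is a pair of families: \<open>v0 T\<close> is the restriction of \<open>v\<^sub>0\<close> to the
  element \<open>T\<close>, and \<open>vb e\<close> is the restriction of \<open>v\<^sub>b\<close> to the edge \<open>e\<close>. Indexing by elements and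
  edges makes \<open>v\<^sub>0\<close> discontinuous across elements and \<open>v\<^sub>b\<close> single valued on each edge but not at
  vertices. Indices outside the mesh carry the zero function, so that equality of pairs is
  equality in \<open>V\<^sub>h\<close>.
\<close>

type_synonym weak_fun = "(R2 set \<Rightarrow> R2 \<Rightarrow> real) \<times> (R2 set \<Rightarrow> R2 \<Rightarrow> real)"

definition Vh :: "nat \<Rightarrow> R2 set set \<Rightarrow> weak_fun set" where
  "Vh k \<T> =
     {(v0, vb). (\<forall>T\<in>\<T>. v0 T \<in> Pk k T) \<and> (\<forall>T. T \<notin> \<T> \<longrightarrow> v0 T = (\<lambda>_. 0)) \<and>
                (\<forall>e\<in>edges \<T>. vb e \<in> Pk (k + 1) e) \<and> (\<forall>e. e \<notin> edges \<T> \<longrightarrow> vb e = (\<lambda>_. 0))}"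

definition Vh0 :: "nat \<Rightarrow> R2 set \<Rightarrow> R2 set set \<Rightarrow> weak_fun set" where
  "Vh0 k \<Omega> \<T> = {v \<in> Vh k \<T>. \<forall>e\<in>boundary_edges \<Omega> \<T>. \<forall>x\<in>e. snd v e x = 0}"

text \<open>
  In the integral over \<open>T\<close> the values of \<open>divergence q\<close> on the boundary of \<open>T\<close>, where the zero
  extension of \<open>q\<close> need not be differentiable, are irrelevant.
\<close>

definition weak_gradient :: "nat \<Rightarrow> weak_fun \<Rightarrow> R2 set \<Rightarrow> R2 \<Rightarrow> R2" where
  "weak_gradient k v T =
     (THE r. r \<in> Pvec (k + 1) T \<and>
        (\<forall>q\<in>Pvec (k + 1) T.
           (LINT x|lebesgue_on T. r x \<bullet> q x) =
             - (LINT x|lebesgue_on T. fst v T x * divergence q x)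
             + (\<Sum>e | e edge_of T. edge_integral e (\<lambda>x. snd v e x * (q x \<bullet> outward_normal T e)))))"

definition Qb :: "nat \<Rightarrow> R2 set \<Rightarrow> (R2 \<Rightarrow> real) \<Rightarrow> R2 \<Rightarrow> real" where
  "Qb k e g =
     (THE p. p \<in> Pk (k + 1) e \<and>
        (\<forall>w\<in>Pk (k + 1) e. edge_integral e (\<lambda>x. p x * w x) = edge_integral e (\<lambda>x. g x * w x)))"

end

theory Submission
  imports Defs "HOL-Library.Function_Algebras"
begin

text \<open>
  The scheme is a symmetric linear system for \<open>u - lift\<close> on the finite-dimensional space \<open>V\<^sub>h\<^sup>0\<close>, where
  \<open>lift\<close> carries the boundary values \<open>Q\<^sub>b g\<close>. Since \<open>a\<close> is elliptic, it suffices to show that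
  \<open>\<nabla>\<^sub>w v = 0\<close> implies \<open>v = 0\<close> for \<open>v \<in> V\<^sub>h\<^sup>0\<close>. On a triangle with vertices \<open>A, B, C\<close> and barycentric
  coordinates \<open>\<lambda>\<^sub>A, \<lambda>\<^sub>B, \<lambda>\<^sub>C\<close> this needs only two kinds of test fields. With \<open>\<tau> = B - A\<close>, the field
  \<open>\<lambda>\<^sub>A \<lambda>\<^sub>B (\<partial>\<^sub>\<tau> v\<^sub>0) \<tau>\<close> has no normal component on the boundary, so integration by parts gives
  \<open>\<integral> \<lambda>\<^sub>A \<lambda>\<^sub>B (\<partial>\<^sub>\<tau> v\<^sub>0)\<^sup>2 = 0\<close>; hence \<open>v\<^sub>0\<close> is a constant \<open>c\<close>. The fields \<open>\<lambda>\<^sub>A m (C - A)\<close> and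
  \<open>\<lambda>\<^sub>B m (C - B)\<close> with \<open>m \<in> P\<^sub>k\<close> see only the edge \<open>AB\<close>, and \<open>\<lambda>\<^sub>A P\<^sub>k + \<lambda>\<^sub>B P\<^sub>k = P\<^sub>k\<^sub>+\<^sub>1\<close> there, so
  \<open>v\<^sub>b = c\<close>. The constants of neighbouring elements agree through \<open>v\<^sub>b\<close>; as \<open>\<Omega>\<close> minus the vertices is
  connected, there is only one constant, and it vanishes on the boundary.
\<close>

section \<open>Linear systems with a semidefinite form\<close>

text \<open>Degrees decide the test fields. A tangential derivative of \<open>v\<^sub>0\<close> has
  degree k - 1, so two barycentric factors use up exactly the degree k + 1 of the gradient space.
  The weight vanishes on two edges and the field is tangential on the third, so the independent
  unknown \<open>v\<^sub>b\<close> drops out. Fields with nonzero flux enter only once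
  \<open>v\<^sub>0\<close> is known to be constant: its volume term is then a flux of the same shape
  as the \<open>v\<^sub>b\<close> term.

  \<open>weak_gradient\<close> and \<open>Qb\<close> are definite descriptions and say nothing until
  existence and uniqueness are known. Both, and the scheme itself, are instances of one Riesz lemma
  for a form on a finitely spanned subspace of functions with pointwise operations. The form may be
  degenerate: the lift lives in \<open>Vh\<close>, and there the energy vanishes on global
  constants.

  Vertices are removed from \<Omega> because elements that touch in a single vertex share no edge
  through which their constants could be compared.\<close>

instantiation "fun" :: (type, real_vector) real_vector
begin

definition scaleR_fun :: "real \<Rightarrow> ('a \<Rightarrow> 'b) \<Rightarrow> 'a \<Rightarrow> 'b"
  where "scaleR_fun r f = (\<lambda>x. r *\<^sub>R f x)"

instance
  by standard (simp_all add: scaleR_fun_def fun_eq_iff scaleR_add_right scaleR_add_left)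

end

lemma scaleR_fun_apply [simp]: "(r *\<^sub>R f) x = r *\<^sub>R f x"
  by (simp add: scaleR_fun_def)

lemma sum_fun_apply: "(\<Sum>i\<in>I. f i) x = (\<Sum>i\<in>I. f i x)"
  for f :: "'i \<Rightarrow> 'a \<Rightarrow> 'b::comm_monoid_add"
  by (induction I rule: infinite_finite_induct) auto

text \<open>The laws are asked for on \<open>V\<close> only, because the forms are integrals and
  additive just where the integrands are integrable. Symmetry supplies linearity in the second
  argument; definiteness is added in \<open>riesz_unique\<close>.\<close>

locale semidefinite_form =
  fixes V :: "'v::real_vector set" and A :: "'v \<Rightarrow> 'v \<Rightarrow> real"
  assumes V: "subspace V"
    and add: "\<lbrakk>u \<in> V; v \<in> V; w \<in> V\<rbrakk> \<Longrightarrow> A (u + v) w = A u w + A v w"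
    and scale: "\<lbrakk>u \<in> V; w \<in> V\<rbrakk> \<Longrightarrow> A (r *\<^sub>R u) w = r * A u w"
    and sym: "\<lbrakk>u \<in> V; w \<in> V\<rbrakk> \<Longrightarrow> A u w = A w u"
    and nonneg: "u \<in> V \<Longrightarrow> A u u \<ge> 0"
begin

lemma add_right: "\<lbrakk>u \<in> V; v \<in> V; w \<in> V\<rbrakk> \<Longrightarrow> A w (u + v) = A w u + A w v"
  using add sym V by (metis subspace_add)

lemma scale_right: "\<lbrakk>u \<in> V; w \<in> V\<rbrakk> \<Longrightarrow> A w (r *\<^sub>R u) = r * A w u"
  using scale sym V by (metis subspace_scale)

text \<open>The degenerate case of Cauchy-Schwarz: along \<open>r u + w\<close> the form is affine
  in \<open>r\<close>, and an affine function bounded below has slope zero.\<close>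

lemma kernel: assumes "u \<in> V" "w \<in> V" "A u u = 0" shows "A u w = 0"
proof (rule ccontr)
  assume ne: "A u w \<noteq> 0"
  \<comment> \<open>Solves \<open>2 * r * A u w + A w w = -1\<close>, which is a negative value of
    the form.\<close>
  define r where "r = - (A w w + 1) / (2 * A u w)"
  have [simp]: "r *\<^sub>R u \<in> V" "r *\<^sub>R u + w \<in> V"
    using assms V by (auto simp: subspace_add subspace_scale)
  have "A (r *\<^sub>R u + w) (r *\<^sub>R u + w) = r * r * A u u + 2 * r * A u w + A w w"
    using assms sym[of w u] by (simp add: add add_right scale scale_right) 
  also have "\<dots> = -1"
    using assms ne by (simp add: r_def field_simps)
  finally show False
    using nonneg[of "r *\<^sub>R u + w"] by simp
qed

text \<open>Gram--Schmidt, one spanning vector at a time. Vectors of length zero cost nothing, because the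
  functional vanishes on them.\<close>

lemma riesz_span:
  assumes "finite B" "span B \<subseteq> V"
    and Fadd: "\<And>u v. \<lbrakk>u \<in> V; v \<in> V\<rbrakk> \<Longrightarrow> F (u + v) = F u + F v"
    and Fscale: "\<And>r u. u \<in> V \<Longrightarrow> F (r *\<^sub>R u) = r * F u"
    and Fker: "\<And>u. \<lbrakk>u \<in> V; A u u = 0\<rbrakk> \<Longrightarrow> F u = 0"
  shows "\<exists>u\<in>span B. \<forall>v\<in>span B. A u v = F v"
  using assms
proof (induction B arbitrary: F rule: finite_induct)
  case empty
  have "0 \<in> V" using V by (simp add: subspace_0)
  then have "A 0 0 = 0" "F 0 = 0"
    using scale[of 0 0 0] empty(3)[of 0 0] by auto
  then show ?case by simp
next
  case (insert b B)
  have sub: "span B \<subseteq> V" "b \<in> V"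
    using insert.prems(1) span_mono[of B "insert b B"] span_base[of b "insert b B"] by auto
  \<comment> \<open>The induction hypothesis for the functional \<open>A b\<close> gives the
    orthogonal projection of \<open>b\<close> onto \<open>span B\<close>. It applies because
    \<open>kernel\<close> makes \<open>A b\<close> vanish on null vectors.\<close>
  obtain p where p: "p \<in> span B" "\<And>v. v \<in> span B \<Longrightarrow> A p v = A b v"
    using insert.IH[of "A b"] sub add_right scale_right kernel sym by (metis (no_types, lifting))
  obtain u where u: "u \<in> span B" "\<And>v. v \<in> span B \<Longrightarrow> A u v = F v"
    using insert.IH[of F] sub insert.prems by metis
  define w where "w = b + (-1) *\<^sub>R p"
  have V_simps [simp]: "p \<in> V" "u \<in> V" "b \<in> V" "w \<in> V" "r *\<^sub>R w \<in> V" "- p \<in> V"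
    and vV: "\<And>v. v \<in> span B \<Longrightarrow> v \<in> V" for r
    using p u sub V by (auto simp: w_def subspace_diff subspace_scale subspace_neg)
  have orth: "A w v = 0" if "v \<in> span B" for v
  proof -
    have "A w v = A b v + A ((-1) *\<^sub>R p) v"
      unfolding w_def by (rule add) (use that vV V_simps in auto)
    also have "A ((-1) *\<^sub>R p) v = - A p v" using scale[OF V_simps(1) vV[OF that], of "-1"] by simp
    finally show ?thesis using p that by simp
  qed
  obtain r where r: "F w = A u w + r * A w w"
  proof (cases "A w w = 0")
    case True
    then have "F w = 0" "A u w = 0"
      using insert.prems(4) kernel[of w u] sym[of u w] by auto
    with True that[of 0] show ?thesis by simp
  next
    case False
    then show ?thesis using that[of "(F w - A u w) / A w w"] by simp
  qed
  have "A (u + r *\<^sub>R w) x = F x" if xs: "x \<in> span (insert b B)" for x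
  proof -
    obtain s where s: "x - s *\<^sub>R b \<in> span B" using xs span_breakdown_eq[of x b B] by blast
    \<comment> \<open>Writing \<open>b = w + p\<close> moves the share \<open>s p\<close> into
      \<open>span B\<close> and leaves a multiple of \<open>w\<close>.\<close>
    define v where "v = (x - s *\<^sub>R b) + s *\<^sub>R p"
    have v: "v \<in> span B" using s p by (simp add: v_def span_add span_scale)
    have x: "x = v + s *\<^sub>R w" by (simp add: v_def w_def algebra_simps)
    have "A (u + r *\<^sub>R w) x = A u v + s * A u w + r * A w v + r * s * A w w"
      unfolding x using vV[OF v] V by (simp add: add add_right scale scale_right subspace_add subspace_scale algebra_simps)
    also have "\<dots> = F v + s * F w"
      using r orth[OF v] u v by (simp add: algebra_simps)
    also have "\<dots> = F x"
      unfolding x using insert.prems(2)[of v "s *\<^sub>R w"] insert.prems(3)[of w s] vV[OF v] V by (simp add: subspace_scale)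
    finally show ?thesis .
  qed
  moreover have "u + r *\<^sub>R w \<in> span (insert b B)"
    using u p span_mono[of B "insert b B"] span_base[of b "insert b B"]
    by (auto simp: w_def intro!: span_add span_scale span_diff)
  ultimately show ?case by blast
qed

text \<open>The spanning set \<open>B\<close> may stick out of \<open>V\<close>, where the form is
  not controlled. It only bounds the size of a basis that is chosen inside \<open>V\<close>.\<close>

lemma riesz:
  assumes "finite B" "V \<subseteq> span B"
    and "\<And>u v. \<lbrakk>u \<in> V; v \<in> V\<rbrakk> \<Longrightarrow> F (u + v) = F u + F v"
    and "\<And>r u. u \<in> V \<Longrightarrow> F (r *\<^sub>R u) = r * F u"
    and "\<And>u. \<lbrakk>u \<in> V; A u u = 0\<rbrakk> \<Longrightarrow> F u = 0"
  shows "\<exists>u\<in>V. \<forall>v\<in>V. A u v = F v"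
proof -
  obtain C where C: "C \<subseteq> V" "independent C" "V \<subseteq> span C"
    using maximal_independent_subset[of V] by blast
  have "finite C"
    using independent_span_bound[of B C] C assms(1,2) by auto
  moreover have "span C = V" using C V by (metis span_minimal subset_antisym)
  ultimately show ?thesis using riesz_span[of C F] assms(3-5) by simp
qed

text \<open>Definiteness leaves 0 as the only null vector, so the compatibility condition of
  \<open>riesz\<close> shrinks to \<open>F 0 = 0\<close>.\<close>

lemma riesz_unique:
  assumes "finite B" "V \<subseteq> span B"
    and "\<And>u v. \<lbrakk>u \<in> V; v \<in> V\<rbrakk> \<Longrightarrow> F (u + v) = F u + F v"
    and "\<And>r u. u \<in> V \<Longrightarrow> F (r *\<^sub>R u) = r * F u"
    and definite: "\<And>u. \<lbrakk>u \<in> V; A u u = 0\<rbrakk> \<Longrightarrow> u = 0"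
  shows "\<exists>!u. u \<in> V \<and> (\<forall>v\<in>V. A u v = F v)"
proof -
  have "F 0 = 0" using assms(4)[of 0 0] V by (simp add: subspace_0)
  then obtain u where u: "u \<in> V" "\<And>v. v \<in> V \<Longrightarrow> A u v = F v"
    using riesz[of B F] assms by metis
  moreover have "w = u" if w: "w \<in> V" "\<And>v. v \<in> V \<Longrightarrow> A w v = F v" for w
  proof -
    have d: "w + (-1) *\<^sub>R u \<in> V" "(-1) *\<^sub>R u \<in> V" using u w V
      by (auto simp: subspace_diff subspace_neg)
    have "A (w + (-1) *\<^sub>R u) v = 0" if "v \<in> V" for v
      using add[of w "(-1) *\<^sub>R u" v] scale[of u v "-1"] u w d that by simp
    then have "w + (-1) *\<^sub>R u = 0" using definite d by blast
    then show ?thesis by simp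
  qed
  ultimately show ?thesis by blast
qed

end

section \<open>Polynomials in two variables\<close>

definition mono2 :: "nat \<Rightarrow> nat \<Rightarrow> R2 \<Rightarrow> real"
  where "mono2 i j = (\<lambda>x. (x $ 1) ^ i * (x $ 2) ^ j)"

text \<open>Functions on the whole plane, taken as a span so that closure properties follow from
  monomials by \<open>polys_induct\<close>. Restriction to an element or an edge is applied
  afterwards; \<open>Pk_eq\<close> makes the link to coefficient arrays.\<close>

definition polys :: "nat \<Rightarrow> (R2 \<Rightarrow> real) set"
  where "polys n = span {mono2 i j | i j. i + j \<le> n}"

lemma subspace_polys: "subspace (polys n)"
  by (simp add: polys_def)

lemma polys_add: "\<lbrakk>p \<in> polys n; q \<in> polys n\<rbrakk> \<Longrightarrow> (\<lambda>x. p x + q x) \<in> polys n"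
  using subspace_add[OF subspace_polys, of p n q] by (simp add: plus_fun_def)

lemma polys_diff: "\<lbrakk>p \<in> polys n; q \<in> polys n\<rbrakk> \<Longrightarrow> (\<lambda>x. p x - q x) \<in> polys n"
  using subspace_diff[OF subspace_polys, of p n q] by (simp add: fun_diff_def)

lemma polys_cmult: "p \<in> polys n \<Longrightarrow> (\<lambda>x. c * p x) \<in> polys n"
  using subspace_scale[OF subspace_polys, of p n c] by (simp add: scaleR_fun_def)

lemma mono2_in_polys: "i + j \<le> n \<Longrightarrow> mono2 i j \<in> polys n"
  unfolding polys_def by (rule span_base) auto

lemma polys_const: "(\<lambda>x. c) \<in> polys n"
  using polys_cmult[OF mono2_in_polys[of 0 0 n], of c] by (simp add: mono2_def)

lemma polys_coord: "n \<ge> 1 \<Longrightarrow> (\<lambda>x. x $ i) \<in> polys n"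
  using mono2_in_polys[of 1 0 n] mono2_in_polys[of 0 1 n]
  by (cases i rule: exhaust_2[THEN disjE]) (simp_all add: mono2_def)

lemma polys_induct [consumes 1, case_names mono add scale]:
  assumes p: "p \<in> polys n"
    and mono: "\<And>i j. i + j \<le> n \<Longrightarrow> P (mono2 i j)"
    and add: "\<And>p q. \<lbrakk>P p; P q\<rbrakk> \<Longrightarrow> P (\<lambda>x. p x + q x)"
    and scale: "\<And>c p. P p \<Longrightarrow> P (\<lambda>x. c * p x)"
  shows "P p"
proof -
  have "P (\<lambda>x. 0)" using scale[OF mono[of 0 0], of 0] by simp
  then have "subspace (Collect P)"
    using add scale by (auto simp: subspace_def zero_fun_def plus_fun_def scaleR_fun_def)
  moreover have "{mono2 i j | i j. i + j \<le> n} \<subseteq> Collect P" using mono by auto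
  ultimately show ?thesis
    using span_minimal p unfolding polys_def by blast
qed

lemma polys_mult:
  assumes p: "p \<in> polys m" and q: "q \<in> polys n"
  shows "(\<lambda>x. p x * q x) \<in> polys (m + n)"
  using p
proof (induction rule: polys_induct)
  case (mono i j)
  from q show ?case
  proof (induction rule: polys_induct)
    case (mono i' j')
    then have "mono2 (i + i') (j + j') \<in> polys (m + n)"
      using \<open>i + j \<le> m\<close> by (intro mono2_in_polys) simp
    then show ?case by (simp add: mono2_def power_add algebra_simps)
  next
    case (add p q)
    from polys_add[OF this] show ?case by (simp add: distrib_left)
  next
    case (scale c p)
    from polys_cmult[OF this, of c] show ?case by (simp add: mult.left_commute)
  qed
next
  case (add p q)
  from polys_add[OF this] show ?case by (simp add: distrib_right)
next
  case (scale c p)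
  from polys_cmult[OF this, of c] show ?case by (simp add: mult.assoc)
qed

lemma polys_derivative:
  assumes "p \<in> polys n"
  shows "\<exists>p1\<in>polys (n - 1). \<exists>p2\<in>polys (n - 1).
    \<forall>x. (p has_derivative (\<lambda>h. p1 x * h $ 1 + p2 x * h $ 2)) (at x)"
  using assms
proof (induction rule: polys_induct)
  case (mono i j)
  \<comment> \<open>The alternative \<open>c = 0\<close> covers exponents where \<open>i - 1\<close>
    or \<open>j - 1\<close> is truncated at 0: the degree does not drop there, but the factor
    \<open>i\<close> or \<open>j\<close> vanishes.\<close>
  have aux: "(\<lambda>x. c * mono2 i' j' x) \<in> polys (n - 1)" if "i' + j' \<le> n - 1 \<or> c = 0" for i' j' and c :: real
    using that polys_cmult[OF mono2_in_polys[of i' j' "n-1"], of c] polys_const[of 0] by auto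
  have nth: "((\<lambda>x::R2. x $ l) has_derivative (\<lambda>h. h $ l)) (at x)" for l x
    by (rule bounded_linear_imp_has_derivative[OF bounded_linear_vec_nth])
  have "(mono2 i j has_derivative (\<lambda>h. (real i * mono2 (i - 1) j x) * h $ 1 + (real j * mono2 i (j - 1) x) * h $ 2)) (at x)" for x
    unfolding mono2_def
    by (rule derivative_eq_intros refl nth | simp add: fun_eq_iff algebra_simps)+
  moreover have "(\<lambda>x. real i * mono2 (i - 1) j x) \<in> polys (n - 1)" "(\<lambda>x. real j * mono2 i (j - 1) x) \<in> polys (n - 1)"
    by (rule aux, use mono in force)+
  ultimately show ?case
    by (intro bexI[of _ "\<lambda>x. real i * mono2 (i - 1) j x"] bexI[of _ "\<lambda>x. real j * mono2 i (j - 1) x"]) auto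
next
  case (add p q)
  then obtain p1 p2 q1 q2 where *: "p1 \<in> polys (n-1)" "p2 \<in> polys (n-1)" "q1 \<in> polys (n-1)" "q2 \<in> polys (n-1)"
    and d: "\<And>x. (p has_derivative (\<lambda>h. p1 x * h $ 1 + p2 x * h $ 2)) (at x)"
      "\<And>x. (q has_derivative (\<lambda>h. q1 x * h $ 1 + q2 x * h $ 2)) (at x)"
    by blast
  have "((\<lambda>x. p x + q x) has_derivative (\<lambda>h. (p1 x + q1 x) * h $ 1 + (p2 x + q2 x) * h $ 2)) (at x)" for x
    using has_derivative_add[OF d(1) d(2)] by (simp add: algebra_simps)
  then show ?case using *
    by (intro bexI[of _ "\<lambda>x. p1 x + q1 x"] bexI[of _ "\<lambda>x. p2 x + q2 x"]) (auto intro: polys_add)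
next
  case (scale c p)
  then obtain p1 p2 where *: "p1 \<in> polys (n-1)" "p2 \<in> polys (n-1)"
    and d: "\<And>x. (p has_derivative (\<lambda>h. p1 x * h $ 1 + p2 x * h $ 2)) (at x)"
    by blast
  have "((\<lambda>x. c * p x) has_derivative (\<lambda>h. (c * p1 x) * h $ 1 + (c * p2 x) * h $ 2)) (at x)" for x
    using has_derivative_mult_right[OF d(1), of c] by (simp add: algebra_simps)
  then show ?case using *
    by (intro bexI[of _ "\<lambda>x. c * p1 x"] bexI[of _ "\<lambda>x. c * p2 x"]) (auto intro: polys_cmult)
qed

lemma polys_continuous: "p \<in> polys n \<Longrightarrow> continuous_on S p"
  by (induction rule: polys_induct) (auto simp: mono2_def intro!: continuous_intros)

section \<open>Zero extensions and the local polynomial spaces\<close>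

definition restr :: "R2 set \<Rightarrow> (R2 \<Rightarrow> 'b::zero) \<Rightarrow> R2 \<Rightarrow> 'b"
  where "restr S f = (\<lambda>x. if x \<in> S then f x else 0)"

lemma Pk_eq: "Pk n S = restr S ` polys n"
proof (intro subset_antisym subsetI)
  fix p assume "p \<in> Pk n S"
  then obtain c :: "nat \<Rightarrow> nat \<Rightarrow> real" where
    "p = restr S (\<lambda>x. \<Sum>i\<le>n. \<Sum>j\<le>n - i. c i j * (x $ 1) ^ i * (x $ 2) ^ j)"
    by (auto simp: Pk_def restr_def)
  moreover have "(\<lambda>x. \<Sum>i\<le>n. \<Sum>j\<le>n - i. c i j * (x $ 1) ^ i * (x $ 2) ^ j)
      = (\<Sum>i\<le>n. \<Sum>j\<le>n - i. c i j *\<^sub>R mono2 i j)"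
    by (simp add: fun_eq_iff sum_fun_apply mono2_def mult.assoc)
  moreover have "\<dots> \<in> polys n"
    by (intro subspace_sum subspace_scale subspace_polys mono2_in_polys) auto
  ultimately show "p \<in> restr S ` polys n" by auto
next
  fix p assume "p \<in> restr S ` polys n"
  then obtain q where q: "q \<in> polys n" "p = restr S q" by auto
  have "\<exists>c. \<forall>x. q x = (\<Sum>i\<le>n. \<Sum>j\<le>n - i. c i j * (x $ 1) ^ i * (x $ 2) ^ j)"
    using q(1)
  proof (induction rule: polys_induct)
    case (mono i j)
    have "mono2 i j x = (\<Sum>i'\<le>n. \<Sum>j'\<le>n - i'. (if i' = i \<and> j' = j then 1 else 0) * (x $ 1) ^ i' * (x $ 2) ^ j')" for x
    proof -
      have "(\<Sum>i'\<le>n. \<Sum>j'\<le>n - i'. (if i' = i \<and> j' = j then 1 else 0) * (x $ 1) ^ i' * (x $ 2) ^ j')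
        = (\<Sum>i'\<le>n. if i' = i then \<Sum>j'\<le>n - i'. if j' = j then mono2 i j x else 0 else 0)"
        by (intro sum.cong refl) (auto simp: mono2_def if_distrib[of "\<lambda>c. c * _"] cong: if_cong)
      also have "\<dots> = mono2 i j x" using mono by simp
      finally show ?thesis by simp
    qed
    then show ?case by (intro exI[of _ "\<lambda>i' j'. if i' = i \<and> j' = j then 1 else 0"]) blast
  next
    case (add p q)
    then obtain c d where "\<forall>x. p x = (\<Sum>i\<le>n. \<Sum>j\<le>n - i. c i j * (x $ 1) ^ i * (x $ 2) ^ j)"
      "\<forall>x. q x = (\<Sum>i\<le>n. \<Sum>j\<le>n - i. d i j * (x $ 1) ^ i * (x $ 2) ^ j)" by blast
    then show ?case
      by (intro exI[of _ "\<lambda>i j. c i j + d i j"]) (simp add: sum.distrib algebra_simps)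
  next
    case (scale a p)
    then obtain c where "\<forall>x. p x = (\<Sum>i\<le>n. \<Sum>j\<le>n - i. c i j * (x $ 1) ^ i * (x $ 2) ^ j)" by blast
    then show ?case
      by (intro exI[of _ "\<lambda>i j. a * c i j"]) (simp add: sum_distrib_left algebra_simps)
  qed
  then show "p \<in> Pk n S" using q(2) unfolding Pk_def restr_def by (auto simp: fun_eq_iff)
qed

lemma subspace_Pk: "subspace (Pk n S)"
proof -
  have "linear (restr S :: _ \<Rightarrow> R2 \<Rightarrow> real)"
    by (rule linearI) (auto simp: restr_def fun_eq_iff)
  then show ?thesis unfolding Pk_eq using subspace_polys by (rule linear_subspace_image)
qed

lemma Pk_finite_span: "\<exists>B. finite B \<and> Pk n S \<subseteq> span B"
proof -
  have lin: "linear (restr S :: _ \<Rightarrow> R2 \<Rightarrow> real)"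
    by (rule linearI) (auto simp: restr_def fun_eq_iff)
  have "{mono2 i j | i j. i + j \<le> n} \<subseteq> case_prod mono2 ` ({..n} \<times> {..n})"
    by (auto simp: image_iff)
  then have "finite {mono2 i j | i j. i + j \<le> n}" by (rule finite_subset) auto
  then show ?thesis
    by (intro exI[of _ "restr S ` {mono2 i j | i j. i + j \<le> n}"])
      (simp add: Pk_eq polys_def linear_span_image[OF lin])
qed

lemma restr_in_Pk: "p \<in> polys n \<Longrightarrow> restr S p \<in> Pk n S"
  by (auto simp: Pk_eq)

lemma PkE:
  assumes "p \<in> Pk n S"
  obtains p' where "p' \<in> polys n" "p = restr S p'"
  using assms by (auto simp: Pk_eq)

lemma Pk_continuous: "p \<in> Pk n S \<Longrightarrow> continuous_on S p"
  by (elim PkE) (simp add: restr_def polys_continuous cong: continuous_on_cong)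

lemma restr_vec_nth: "restr S q x $ i = restr S (\<lambda>x. q x $ i) x"
  by (simp add: restr_def)

lemma Pvec_eq: "Pvec n S = {restr S (\<lambda>x. (vector [p x, q x] :: R2)) | p q. p \<in> polys n \<and> q \<in> polys n}"
proof (intro subset_antisym subsetI)
  fix r assume "r \<in> Pvec n S"
  then have r: "(\<lambda>x. r x $ 1) \<in> Pk n S" "(\<lambda>x. r x $ 2) \<in> Pk n S" by (auto simp: Pvec_def)
  obtain p where "p \<in> polys n" "(\<lambda>x. r x $ 1) = restr S p" using r(1) by (rule PkE)
  moreover obtain q where "q \<in> polys n" "(\<lambda>x. r x $ 2) = restr S q" using r(2) by (rule PkE)
  moreover from calculation have "r = restr S (\<lambda>x. (vector [p x, q x] :: R2))"
    by (auto simp: fun_eq_iff vec_eq_iff forall_2 restr_vec_nth)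
  ultimately show "r \<in> {restr S (\<lambda>x. (vector [p x, q x] :: R2)) | p q. p \<in> polys n \<and> q \<in> polys n}" by blast
next
  fix r assume "r \<in> {restr S (\<lambda>x. (vector [p x, q x] :: R2)) | p q. p \<in> polys n \<and> q \<in> polys n}"
  then show "r \<in> Pvec n S" by (auto simp: Pvec_def restr_vec_nth forall_2 intro: restr_in_Pk)
qed

lemma subspace_Pvec: "subspace (Pvec n S)"
  using subspace_Pk[of n S] unfolding subspace_def Pvec_def
  by (simp add: zero_fun_def plus_fun_def scaleR_fun_def)

lemma Pvec_continuous: "q \<in> Pvec n S \<Longrightarrow> continuous_on S q"
  using continuous_on_vec_lambda[of S "\<lambda>i x. q x $ i"] by (auto simp: Pvec_def intro: Pk_continuous)

lemma Pvec_outside: "\<lbrakk>q \<in> Pvec n S; x \<notin> S\<rbrakk> \<Longrightarrow> q x = 0"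
  by (auto simp: Pvec_eq restr_def)

lemma Pvec_finite_span: "\<exists>B. finite B \<and> Pvec n S \<subseteq> span B"
proof -
  define E :: "2 \<Rightarrow> (R2 \<Rightarrow> real) \<Rightarrow> R2 \<Rightarrow> R2" where "E i p = (\<lambda>x. p x *\<^sub>R axis i 1)" for i p
  have lin: "linear (E i)" for i
    by (rule linearI) (auto simp: E_def fun_eq_iff algebra_simps)
  obtain B where B: "finite B" "Pk n S \<subseteq> span B" using Pk_finite_span by blast
  have "q \<in> span (E 1 ` B \<union> E 2 ` B)" if q: "q \<in> Pvec n S" for q :: "R2 \<Rightarrow> R2"
  proof -
    have "(q :: R2 \<Rightarrow> R2) = E 1 (\<lambda>x. q x $ 1) + E 2 (\<lambda>x. q x $ 2)"
      by (auto simp: fun_eq_iff vec_eq_iff forall_2 E_def axis_def)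
    moreover have "E i (\<lambda>x. q x $ i) \<in> span (E i ` B)" for i
      using q B linear_span_image[OF lin[of i], of B] by (auto simp: Pvec_def)
    then have "E 1 (\<lambda>x. q x $ 1) \<in> span (E 1 ` B \<union> E 2 ` B)" "E 2 (\<lambda>x. q x $ 2) \<in> span (E 1 ` B \<union> E 2 ` B)"
      by (meson span_mono subsetD sup_ge1 sup_ge2)+
    ultimately show ?thesis by (metis span_add)
  qed
  then show ?thesis using B by (intro exI[of _ "E 1 ` B \<union> E 2 ` B"]) auto
qed

section \<open>The divergence theorem on a triangle\<close>

lemma compact_imp_sets_lebesgue: "compact S \<Longrightarrow> S \<in> sets lebesgue"
  for S :: "'a::euclidean_space set"
  by (simp add: lmeasurable_compact fmeasurableD)

text \<open>The development integrates over \<open>lebesgue_on\<close>, whereas Fubini and the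
  fundamental theorem are applied over \<open>lborel\<close>. For a continuous function cut off by a
  compact set the integrand is Borel, so the completion changes nothing.\<close>

lemma
  fixes f :: "'a::euclidean_space \<Rightarrow> real"
  assumes "compact S" "continuous_on S f"
  shows integrable_compact: "integrable (lebesgue_on S) f"
    and integral_compact_lborel: "integral\<^sup>L (lebesgue_on S) f = (\<integral>x. indicator S x * f x \<partial>lborel)"
proof -
  have int: "integrable lborel (\<lambda>x. indicator S x * f x)"
    using borel_integrable_compact[OF assms] by simp
  have S: "S \<inter> space lebesgue \<in> sets lebesgue"
    using assms compact_imp_sets_lebesgue by auto
  show "integrable (lebesgue_on S) f"
    using int integrable_completion[of "\<lambda>x. indicator S x * f x" lborel]
    by (simp add: integrable_restrict_space[OF S] borel_measurable_integrable)
  show "integral\<^sup>L (lebesgue_on S) f = (\<integral>x. indicator S x * f x \<partial>lborel)"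
    using int integral_completion[of "\<lambda>x. indicator S x * f x" lborel]
    by (simp add: integral_restrict_space[OF S] borel_measurable_integrable)
qed

definition pt :: "real \<Rightarrow> real \<Rightarrow> R2"
  where "pt s t = s *\<^sub>R axis 1 1 + t *\<^sub>R axis 2 1"

lemma pt_nth [simp]: "pt s t $ 1 = s" "pt s t $ 2 = t"
  by (simp_all add: pt_def axis_def)

lemma Basis_R2: "(Basis :: R2 set) = {axis 1 1, axis 2 1}"
  by (auto simp: Basis_vec_def UNIV_2)

text \<open>Transports Fubini from pairs of reals to vectors. Lebesgue measure is determined by its
  values on boxes, and both sides give a box the product of its side lengths.\<close>

lemma lborel_R2: "(lborel :: R2 measure) = distr (lborel \<Otimes>\<^sub>M lborel) borel (\<lambda>(s, t). pt s t)"
proof (rule lborel_eqI)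
  have [measurable]: "(\<lambda>(s, t). pt s t) \<in> borel_measurable (lborel \<Otimes>\<^sub>M lborel)"
    unfolding pt_def by measurable
  show "sets (distr (lborel \<Otimes>\<^sub>M lborel) borel (\<lambda>(s, t). pt s t)) = sets borel" by simp
  fix l u :: R2
  assume le: "\<And>b. b \<in> Basis \<Longrightarrow> l \<bullet> b \<le> u \<bullet> b"
  have "(\<lambda>(s, t). pt s t) -` box l u \<inter> space (lborel \<Otimes>\<^sub>M lborel) = {l $ 1<..<u $ 1} \<times> {l $ 2<..<u $ 2}"
    by (auto simp: space_pair_measure mem_box_cart forall_2)
  then have "emeasure (distr (lborel \<Otimes>\<^sub>M lborel) borel (\<lambda>(s, t). pt s t)) (box l u)
      = emeasure (lborel \<Otimes>\<^sub>M lborel) ({l $ 1<..<u $ 1} \<times> {l $ 2<..<u $ 2})"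
    by (simp add: emeasure_distr)
  also have "\<dots> = emeasure lborel {l $ 1<..<u $ 1} * emeasure lborel {l $ 2<..<u $ 2}"
    by (rule lborel.emeasure_pair_measure_Times) auto
  also have "\<dots> = (u $ 1 - l $ 1) * (u $ 2 - l $ 2)"
    using le[of "axis 1 1"] le[of "axis 2 1"]
    by (simp add: Basis_R2 inner_axis ennreal_mult'')
  also have "(u $ 1 - l $ 1) * (u $ 2 - l $ 2) = (\<Prod>b\<in>Basis. (u - l) \<bullet> b)"
    by (simp add: Basis_R2 inner_axis axis_eq_axis)
  finally show "emeasure (distr (lborel \<Otimes>\<^sub>M lborel) borel (\<lambda>(s, t). pt s t)) (box l u) = (\<Prod>b\<in>Basis. (u - l) \<bullet> b)" .
qed

lemma integral_R2_iterated:
  fixes f :: "R2 \<Rightarrow> real"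
  assumes "integrable lborel f"
  shows "(\<integral>x. f x \<partial>lborel) = (\<integral>t. (\<integral>s. f (pt s t) \<partial>lborel) \<partial>lborel)"
proof -
  have m [measurable]: "(\<lambda>(s, t). pt s t) \<in> borel_measurable (lborel \<Otimes>\<^sub>M lborel)"
    unfolding pt_def by measurable
  have f [measurable]: "f \<in> borel_measurable borel"
    using assms borel_measurable_integrable by fastforce
  have *: "(\<lambda>x. f (case x of (s, t) \<Rightarrow> pt s t)) = (\<lambda>(s, t). f (pt s t))" by auto
  have "integrable (distr (lborel \<Otimes>\<^sub>M lborel) borel (\<lambda>(s, t). pt s t)) f"
    using assms by (subst (asm) lborel_R2)
  then have "integrable (lborel \<Otimes>\<^sub>M lborel) (\<lambda>(s, t). f (pt s t))"
    using integrable_distr_eq[OF m f] unfolding * by simp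
  from lborel_pair.integral_snd[OF this]
  have "(\<integral>t. (\<integral>s. f (pt s t) \<partial>lborel) \<partial>lborel) = integral\<^sup>L (lborel \<Otimes>\<^sub>M lborel) (\<lambda>(s, t). f (pt s t))" .
  also have "\<dots> = (\<integral>x. f x \<partial>lborel)"
    using integral_distr[OF m f] unfolding lborel_R2[symmetric] * ..
  finally show ?thesis ..
qed

definition unit_triangle :: "R2 set"
  where "unit_triangle = {x. 0 \<le> x $ 1 \<and> 0 \<le> x $ 2 \<and> x $ 1 + x $ 2 \<le> 1}"

lemma pt_eta: "pt (x $ 1) (x $ 2) = x"
  by (simp add: vec_eq_iff forall_2)

lemma compact_unit_triangle: "compact unit_triangle"
proof -
  have "closed unit_triangle"
    unfolding unit_triangle_def
    by (intro closed_Collect_conj closed_Collect_le continuous_intros)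
  moreover have "unit_triangle \<subseteq> cbox (pt 0 0) (pt 1 1)"
    by (auto simp: unit_triangle_def mem_box_cart forall_2)
  ultimately show ?thesis
    using compact_Int_closed[OF compact_cbox] by (metis inf.absorb_iff2)
qed

text \<open>At height \<open>t\<close> the triangle is the interval from 0 to 1 - t, so the
  fundamental theorem leaves the hypotenuse and the vertical leg. The horizontal leg is parallel to
  the direction of differentiation and contributes no flux.\<close>

lemma integral_unit_triangle_deriv:
  fixes \<psi> D :: "R2 \<Rightarrow> real"
  assumes cont: "continuous_on UNIV \<psi>" "continuous_on UNIV D"
    and D: "\<And>s t. ((\<lambda>s. \<psi> (pt s t)) has_real_derivative D (pt s t)) (at s)"
  shows "(LINT x|lebesgue_on unit_triangle. D x)
    = (LINT t|lebesgue_on {0..1}. \<psi> (pt (1 - t) t)) - (LINT t|lebesgue_on {0..1}. \<psi> (pt 0 t))"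
proof -
  have c: "continuous_on S (\<lambda>x. pt (f x) (g x))" if "continuous_on S f" "continuous_on S g"
    for f g and S :: "real set"
    unfolding pt_def by (intro continuous_intros that)
  have c\<psi>: "continuous_on S (\<lambda>x. \<psi> (pt (f x) (g x)))" if "continuous_on S f" "continuous_on S g"
    for f g and S :: "real set"
    using continuous_on_compose2[OF cont(1) c[OF that]] by auto
  have cD: "continuous_on S (\<lambda>s. D (pt s t))" for t and S :: "real set"
    using continuous_on_compose2[OF cont(2) c[of S "\<lambda>x. x" "\<lambda>_. t"]] by auto
  have D': "((\<lambda>s. \<psi> (pt s t)) has_vector_derivative D (pt s t)) (at s within S)" for s t S
    using D[of t s] has_field_derivative_at_within has_real_derivative_iff_has_vector_derivative by blast
  have inner: "(\<integral>s. indicator unit_triangle (pt s t) * D (pt s t) \<partial>lborel)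
      = indicator {0..1} t * (\<psi> (pt (1 - t) t) - \<psi> (pt 0 t))" for t
  proof (cases "t \<in> {0..1}")
    case True
    then have "(\<integral>s. indicator unit_triangle (pt s t) * D (pt s t) \<partial>lborel)
       = (\<integral>s. indicator {0..1 - t} s *\<^sub>R D (pt s t) \<partial>lborel)"
      by (intro Bochner_Integration.integral_cong) (auto simp: unit_triangle_def indicator_def)
    also have "\<dots> = \<psi> (pt (1 - t) t) - \<psi> (pt 0 t)"
      using True D' cD by (intro integral_FTC_Icc) auto
    finally show ?thesis using True by simp
  next
    case False
    then have "pt s t \<notin> unit_triangle" for s by (auto simp: unit_triangle_def)
    then show ?thesis using False by simp
  qed
  have "(LINT x|lebesgue_on unit_triangle. D x) = (\<integral>x. indicator unit_triangle x * D x \<partial>lborel)"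
    using cont by (intro integral_compact_lborel compact_unit_triangle) (auto intro: continuous_on_subset)
  also have "\<dots> = (\<integral>t. (\<integral>s. indicator unit_triangle (pt s t) * D (pt s t) \<partial>lborel) \<partial>lborel)"
    using borel_integrable_compact[OF compact_unit_triangle continuous_on_subset[OF cont(2)]]
    by (intro integral_R2_iterated) auto
  also have "\<dots> = (LINT t|lebesgue_on {0..1}. \<psi> (pt (1 - t) t) - \<psi> (pt 0 t))"
    unfolding inner
    by (rule integral_compact_lborel[symmetric]) (auto intro!: continuous_intros c\<psi>)
  also have "\<dots> = (LINT t|lebesgue_on {0..1}. \<psi> (pt (1 - t) t)) - (LINT t|lebesgue_on {0..1}. \<psi> (pt 0 t))"
    by (intro Bochner_Integration.integral_diff integrable_compact) (auto intro!: continuous_intros c\<psi>)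
  finally show ?thesis .
qed

text \<open>The determinant of the two vectors; for two sides of a triangle from a common vertex,
  twice its signed area.\<close>

definition cross2 :: "R2 \<Rightarrow> R2 \<Rightarrow> real"
  where "cross2 u w = u $ 1 * w $ 2 - u $ 2 * w $ 1"

lemma triangle_eq_image:
  fixes A B C :: R2
  shows "convex hull {A, B, C} = (\<lambda>x. A + (x $ 1 *\<^sub>R (B - A) + x $ 2 *\<^sub>R (C - A))) ` unit_triangle"
proof -
  have "x \<in> (\<lambda>x. A + (x $ 1 *\<^sub>R (B - A) + x $ 2 *\<^sub>R (C - A))) ` unit_triangle
    \<longleftrightarrow> (\<exists>u v. x = A + u *\<^sub>R (B - A) + v *\<^sub>R (C - A) \<and> 0 \<le> u \<and> 0 \<le> v \<and> u + v \<le> 1)" for x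
    unfolding unit_triangle_def image_iff
    by (metis (no_types, lifting) add.assoc mem_Collect_eq pt_nth)
  then show ?thesis unfolding convex_hull_3_alt by blast
qed

lemma cross2_solve:
  assumes "cross2 u w \<noteq> 0" "s *\<^sub>R u + t *\<^sub>R w = s' *\<^sub>R u + t' *\<^sub>R w"
  shows "s = s' \<and> t = t'"
proof -
  have e: "s * u $ 1 + t * w $ 1 = s' * u $ 1 + t' * w $ 1" "s * u $ 2 + t * w $ 2 = s' * u $ 2 + t' * w $ 2"
    using arg_cong[OF assms(2), of "\<lambda>v. v $ 1"] arg_cong[OF assms(2), of "\<lambda>v. v $ 2"] by auto
  have "(s - s') * cross2 u w = 0" "(t - t') * cross2 u w = 0"
    using e unfolding cross2_def by algebra+
  then show ?thesis using assms by auto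
qed

lemma integral_triangle:
  fixes A B C :: R2 and h :: "R2 \<Rightarrow> real"
  assumes nz: "cross2 (B - A) (C - A) \<noteq> 0" and h: "continuous_on (convex hull {A, B, C}) h"
  shows "(LINT x|lebesgue_on (convex hull {A, B, C}). h x)
    = \<bar>cross2 (B - A) (C - A)\<bar> * (LINT x|lebesgue_on unit_triangle. h (A + (x $ 1 *\<^sub>R (B - A) + x $ 2 *\<^sub>R (C - A))))"
proof -
  define g where "g = (\<lambda>x::R2. A + (x $ 1 *\<^sub>R (B - A) + x $ 2 *\<^sub>R (C - A)))"
  define g' where "g' = (\<lambda>x::R2. x $ 1 *\<^sub>R (B - A) + x $ 2 *\<^sub>R (C - A))"
  have lin: "linear g'"
    by (rule linearI) (auto simp: g'_def algebra_simps)
  have g: "(g has_derivative g') (at x within S)" for x S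
    using has_derivative_add[OF has_derivative_const linear_imp_has_derivative[OF lin]]
    by (simp add: g_def g'_def)
  have cg: "continuous_on S g" for S
    using g by (meson continuous_at_imp_continuous_on has_derivative_continuous)
  have inj: "inj_on g unit_triangle"
    using cross2_solve[OF nz] by (auto simp: inj_on_def g_def) (metis pt_eta)
  have det: "det (matrix g') = cross2 (B - A) (C - A)"
    by (simp add: det_2 matrix_def g'_def cross2_def axis_def algebra_simps)
  have T: "convex hull {A, B, C} = g ` unit_triangle"
    unfolding triangle_eq_image g_def ..
  have cT: "compact (convex hull {A, B, C})"
    using compact_unit_triangle cg unfolding T by (metis compact_continuous_image)
  have hg: "continuous_on unit_triangle (\<lambda>x. h (g x))"
    using continuous_on_compose2[OF h cg] T by blast
  have m: "unit_triangle \<in> sets lebesgue" "convex hull {A,B,C} \<in> sets lebesgue"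
    using compact_imp_sets_lebesgue compact_unit_triangle cT by blast+
  \<comment> \<open>The change of variables theorem speaks of values in \<open>real^'n\<close>, so
    the real integrand passes through \<open>real^1\<close>.\<close>
  define f :: "R2 \<Rightarrow> real^1" where "f = (\<lambda>x. vec (h x))"
  have "(\<lambda>x. f x $ 1) absolutely_integrable_on (g ` unit_triangle)"
    using integrable_compact[OF cT h] m T
    by (simp add: f_def integrable_restrict_space set_integrable_def)
  then have "f absolutely_integrable_on (g ` unit_triangle) \<and> integral (g ` unit_triangle) f = vec (integral (g ` unit_triangle) h)"
    using integral_on_1_eq[of "g ` unit_triangle" f]
    by (simp add: absolutely_integrable_on_1_iff) (simp add: f_def)
  then have "integral unit_triangle (\<lambda>x. \<bar>det (matrix g')\<bar> *\<^sub>R f (g x)) = vec (integral (g ` unit_triangle) h)"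
    using has_absolute_integral_change_of_variables[OF m(1) g inj, of f] by blast
  moreover have "integral unit_triangle (\<lambda>x. \<bar>det (matrix g')\<bar> *\<^sub>R f (g x))
    = vec (integral unit_triangle (\<lambda>x. \<bar>det (matrix g')\<bar> * h (g x)))"
    by (subst integral_on_1_eq) (simp add: f_def)
  ultimately have "integral unit_triangle (\<lambda>x. \<bar>det (matrix g')\<bar> * h (g x)) = integral (g ` unit_triangle) h"
    by (metis vec_component)
  then have "integral (g ` unit_triangle) h = \<bar>det (matrix g')\<bar> * integral unit_triangle (\<lambda>x. h (g x))"
    by simp
  then show ?thesis
    using lebesgue_integral_eq_integral[OF integrable_compact[OF cT h] m(2)]
      lebesgue_integral_eq_integral[OF integrable_compact[OF compact_unit_triangle hg] m(1)]
    by (simp add: det T g_def)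
qed

lemma integral_reflect_01:
  fixes f :: "real \<Rightarrow> real"
  shows "(LINT t|lebesgue_on {0..1}. f (1 - t)) = (LINT t|lebesgue_on {0..1}. f t)"
proof -
  have "(LINT t|lebesgue_on {0..1}. f t) = (\<integral>t. indicator {0..1} t *\<^sub>R f t \<partial>lebesgue)"
    by (rule integral_restrict_space) auto
  also have "\<dots> = (\<integral>t. indicator {0..1} (1 + (-1) * t) *\<^sub>R f (1 + (-1) * t) \<partial>lebesgue)"
    using lebesgue_integral_real_affine[of "-1" "\<lambda>t. indicator {0..1} t *\<^sub>R f t" 1] by simp
  also have "\<dots> = (\<integral>t. indicator {0..1} t *\<^sub>R f (1 - t) \<partial>lebesgue)"
    by (intro Bochner_Integration.integral_cong) (auto simp: indicator_def)
  also have "\<dots> = (LINT t|lebesgue_on {0..1}. f (1 - t))"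
    by (rule integral_restrict_space[symmetric]) auto
  finally show ?thesis ..
qed

lemma integral_linepath_commute:
  fixes f :: "R2 \<Rightarrow> real"
  shows "(LINT t|lebesgue_on {0..1}. f (linepath P Q t)) = (LINT t|lebesgue_on {0..1}. f (linepath Q P t))"
  using integral_reflect_01[of "\<lambda>t. f (linepath P Q t)"]
  by (simp add: linepath_def algebra_simps)

text \<open>The divergence theorem for the field \<open>\<psi> *\<^sub>R (B - A)\<close>. It is
  tangential on AB; on BC and AC the edge length times the normal component of B - A is plus and
  minus the Jacobian, which is why edge lengths do not show.\<close>

lemma divergence_triangle:
  fixes A B C :: R2 and \<psi> :: "R2 \<Rightarrow> real"
  assumes nz: "cross2 (B - A) (C - A) \<noteq> 0"
    and \<psi>: "\<And>x. (\<psi> has_derivative \<psi>' x) (at x)"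
    and c: "continuous_on UNIV (\<lambda>x. \<psi>' x (B - A))"
  shows "(LINT x|lebesgue_on (convex hull {A, B, C}). \<psi>' x (B - A))
    = \<bar>cross2 (B - A) (C - A)\<bar> * ((LINT t|lebesgue_on {0..1}. \<psi> (linepath B C t)) - (LINT t|lebesgue_on {0..1}. \<psi> (linepath A C t)))"
proof -
  define g where "g = (\<lambda>x::R2. A + (x $ 1 *\<^sub>R (B - A) + x $ 2 *\<^sub>R (C - A)))"
  have cg: "continuous_on S g" for S
    unfolding g_def by (intro continuous_intros)
  have c\<psi>: "continuous_on S \<psi>" for S
    using \<psi> by (meson continuous_at_imp_continuous_on has_derivative_continuous)
  have "((\<lambda>s. \<psi> (g (pt s t))) has_real_derivative \<psi>' (g (pt s t)) (B - A)) (at s)" for s t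
  proof -
    \<comment> \<open>In reference coordinates the direction B - A is the first axis.\<close>
    have "((\<lambda>s. g (pt s t)) has_derivative (\<lambda>h. h *\<^sub>R (B - A))) (at s)"
      unfolding g_def by (auto intro!: derivative_eq_intros)
    from has_derivative_compose[OF this \<psi>]
    have "((\<lambda>s. \<psi> (g (pt s t))) has_derivative (\<lambda>h. \<psi>' (g (pt s t)) (h *\<^sub>R (B - A)))) (at s)" .
    moreover have "linear (\<psi>' (g (pt s t)))" using \<psi> has_derivative_linear by blast
    ultimately show ?thesis
      by (simp add: has_field_derivative_def linear_scale mult_commute_abs)
  qed
  then have "(LINT x|lebesgue_on unit_triangle. \<psi>' (g x) (B - A))
    = (LINT t|lebesgue_on {0..1}. \<psi> (g (pt (1 - t) t))) - (LINT t|lebesgue_on {0..1}. \<psi> (g (pt 0 t)))"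
    using continuous_on_compose2[OF c\<psi>[of UNIV] cg] continuous_on_compose2[OF c cg]
    by (intro integral_unit_triangle_deriv) auto
  moreover have "g (pt (1 - t) t) = linepath B C t" "g (pt 0 t) = linepath A C t" for t
    by (simp_all add: g_def linepath_def algebra_simps)
  ultimately show ?thesis
    using integral_triangle[OF nz, of "\<lambda>x. \<psi>' x (B - A)"] continuous_on_subset[OF c]
    by (simp add: g_def)
qed

section \<open>Triangles, edges and normals\<close>

text \<open>Bridges two mismatches: the divergence of a zero extension is unreliable on the boundary
  of an element, and the data live on \<Omega> while elements reach its frontier.\<close>

lemma
  fixes f g :: "'a::euclidean_space \<Rightarrow> real"
  assumes S: "S \<in> sets lebesgue" and N: "negligible N"
    and eq: "\<And>x. x \<in> S - N \<Longrightarrow> g x = f x" and f: "integrable (lebesgue_on S) f"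
  shows integrable_lebesgue_on_spike: "integrable (lebesgue_on S) g"
    and integral_lebesgue_on_spike: "integral\<^sup>L (lebesgue_on S) g = integral\<^sup>L (lebesgue_on S) f"
proof -
  have "f absolutely_integrable_on S"
    using S f by (simp add: integrable_restrict_space set_integrable_def)
  then have "g absolutely_integrable_on S"
    using absolutely_integrable_spike[OF _ N] eq by metis
  then show int: "integrable (lebesgue_on S) g"
    using S by (simp add: integrable_restrict_space set_integrable_def)
  show "integral\<^sup>L (lebesgue_on S) g = integral\<^sup>L (lebesgue_on S) f"
    using lebesgue_integral_eq_integral[OF f S] lebesgue_integral_eq_integral[OF int S]
      integral_spike[OF N, of S g f] eq by metis
qed

text \<open>The vanishing criterion is for the closure of an open set with the same measure as that
  set. A compact convex set with interior points is of this kind, its boundary being negligible;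
  this serves triangles and the unit interval alike.\<close>

lemma integral_0_convex_imp_0:
  fixes h :: "'a::euclidean_space \<Rightarrow> real"
  assumes S: "compact S" "convex S" "interior S \<noteq> {}"
    and h: "continuous_on S h" "\<And>x. x \<in> S \<Longrightarrow> 0 \<le> h x"
    and int: "(LINT x|lebesgue_on S. h x) = 0" and x: "x \<in> S"
  shows "h x = 0"
proof -
  have cl: "closure (interior S) = S"
    using S convex_closure_interior closure_closed compact_imp_closed by metis
  have m: "S \<in> sets lebesgue" using S compact_imp_sets_lebesgue by blast
  have neg: "negligible (S - interior S)"
    using negligible_convex_frontier[OF S(2)] S(1) by (simp add: frontier_def compact_imp_closed)
  have "emeasure lborel S = emeasure lborel (interior S) + emeasure lborel (S - interior S)"
    using S interior_subset by (subst plus_emeasure) (auto simp: compact_imp_closed Un_absorb1 intro!: arg_cong[where f="emeasure lborel"])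
  also have "emeasure lborel (S - interior S) = 0"
    using neg S by (simp add: negligible_iff_null_sets null_sets_completion_iff compact_imp_closed null_setsD1)
  finally have reg: "emeasure lborel (closure (interior S)) = emeasure lborel (interior S)"
    using cl by simp
  have "emeasure lborel (interior S) \<noteq> 0"
    using S(3) open_not_negligible[OF open_interior]
    by (auto simp: negligible_iff_null_sets null_sets_completion_iff null_sets_def)
  moreover have "emeasure lborel (interior S) < \<infinity>"
    using emeasure_bounded_finite[of "interior S"] S bounded_subset[OF compact_imp_bounded interior_subset] by auto
  moreover have "(h has_integral 0) S"
    using has_integral_integral_lebesgue_on[OF integrable_compact[OF S(1) h(1)] m] int by simp
  ultimately show ?thesis
    using has_integral_0_closure_imp_0[of "interior S" h x] reg h x interior_subset[of S] open_interior
    by (auto simp: cl zero_less_iff_neq_zero)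
qed

text \<open>A segment determines its endpoints up to order, so the chosen pair differs from (P, Q)
  at most by a swap, which the substitution of 1 - t for t absorbs.\<close>

lemma edge_integral_segment:
  "edge_integral (closed_segment P Q) \<phi> = dist P Q * (LINT t|lebesgue_on {0..1}. \<phi> (linepath P Q t))"
proof -
  obtain p q where pq: "(SOME (p, q). closed_segment P Q = closed_segment p q) = (p, q)"
    by (meson surj_pair)
  have "case_prod (\<lambda>p q. closed_segment P Q = closed_segment p q) (SOME (p, q). closed_segment P Q = closed_segment p q)"
    by (rule someI[of _ "(P, Q)"]) simp
  then have "{P, Q} = {p, q}" unfolding pq by simp
  then have "p = P \<and> q = Q \<or> p = Q \<and> q = P" by (auto simp: doubleton_eq_iff)
  then show ?thesis
    unfolding edge_integral_def pq
    using integral_linepath_commute[of \<phi> P Q] by (auto simp: dist_commute)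
qed

lemma cross2_eq_0_imp_collinear:
  assumes "cross2 (B - A) (C - A) = 0"
  shows "collinear {A, B, C}"
proof -
  have "collinear {0, B - A, C - A}"
  proof (cases "B - A = 0")
    case False
    define u w where "u = B - A" and "w = C - A"
    have c: "u $ 1 * w $ 2 = u $ 2 * w $ 1" using assms by (simp add: cross2_def u_def w_def)
    have "u $ 1 \<noteq> 0 \<or> u $ 2 \<noteq> 0" using False by (auto simp: u_def vec_eq_iff forall_2)
    then have "\<exists>k. w = k *\<^sub>R u"
    proof
      assume "u $ 1 \<noteq> 0"
      then show ?thesis using c by (intro exI[of _ "w $ 1 / u $ 1"]) (auto simp: vec_eq_iff forall_2 field_simps)
    next
      assume "u $ 2 \<noteq> 0"
      then show ?thesis using c by (intro exI[of _ "w $ 2 / u $ 2"]) (auto simp: vec_eq_iff forall_2 field_simps)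
    qed
    then show ?thesis by (auto simp: collinear_lemma u_def w_def)
  qed simp
  then have "collinear {B, A, C}" by (subst collinear_3) auto
  then show ?thesis by (simp add: insert_commute)
qed

lemma collinear_imp_cross2_eq_0:
  assumes "collinear {A, B, C}"
  shows "cross2 (B - A) (C - A) = 0"
proof -
  have "collinear {B, A, C}" using assms by (simp add: insert_commute)
  then have "collinear {0, B - A, C - A}" by (subst (asm) collinear_3) auto
  then consider "B - A = 0" | "C - A = 0" | k where "C - A = k *\<^sub>R (B - A)"
    by (auto simp: collinear_lemma)
  then show ?thesis
    by cases (simp_all add: cross2_def del: right_minus_eq vector_minus_component)
qed

text \<open>\<open>lam A B C\<close> is the barycentric coordinate belonging to the vertex \<open>A\<close>.\<close>

definition lam :: "R2 \<Rightarrow> R2 \<Rightarrow> R2 \<Rightarrow> R2 \<Rightarrow> real"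
  where "lam A B C x = cross2 (B - x) (C - x) / cross2 (B - A) (C - A)"

text \<open>The vertices are ordered so that each argument is made for one edge only;
  \<open>triangle_rotate\<close> and \<open>triangle_swap\<close> carry it to the others. Both
  orientations are allowed, hence the absolute value in \<open>J\<close>.\<close>

locale triangle =
  fixes A B C :: R2
  assumes nondegenerate: "cross2 (B - A) (C - A) \<noteq> 0"
begin

definition "T = convex hull {A, B, C}"
definition "J = \<bar>cross2 (B - A) (C - A)\<bar>"

lemma J_pos: "J > 0" using nondegenerate by (simp add: J_def)

lemma compact_T: "compact T"
  unfolding T_def by (rule finite_imp_compact_convex_hull) simp

lemma convex_T: "convex T"
  unfolding T_def by (rule convex_convex_hull)

lemma not_collinear: "\<not> collinear {A, B, C}"
  using nondegenerate collinear_imp_cross2_eq_0 by blast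

lemma distinct: "A \<noteq> B" "B \<noteq> C" "C \<noteq> A"
  using not_collinear unfolding collinear_3_eq_affine_dependent by blast+

lemma affine_independent: "\<not> affine_dependent {A, B, C}"
  using not_collinear unfolding collinear_3_eq_affine_dependent by blast

lemma interior_T: "interior T = {v. \<exists>x y z. 0 < x \<and> 0 < y \<and> 0 < z \<and> x + y + z = 1 \<and> x *\<^sub>R A + y *\<^sub>R B + z *\<^sub>R C = v}"
  unfolding T_def by (rule interior_convex_hull_3_minimal[OF not_collinear]) simp

lemma interior_nonempty: "interior T \<noteq> {}"
proof -
  have "(1/3) *\<^sub>R A + (1/3) *\<^sub>R B + (1/3) *\<^sub>R C \<in> interior T"
    unfolding interior_T by (intro CollectI exI[of _ "1/3::real"]) auto
  then show ?thesis by blast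
qed

lemma negligible_boundary: "negligible (T - interior T)"
  using negligible_convex_frontier[OF convex_T] compact_T by (simp add: frontier_def compact_imp_closed)

text \<open>Faces of a simplex are the hulls of subsets of its vertices, and dimension 1 forces two
  vertices.\<close>

lemma edge_iff: "e edge_of T \<longleftrightarrow> e \<in> {closed_segment A B, closed_segment B C, closed_segment C A}"
proof
  assume e: "e edge_of T"
  then obtain c where c: "c \<subseteq> {A, B, C}" "e = convex hull c"
    using face_of_convex_hull_affine_independent[OF affine_independent]
    unfolding edge_of_def T_def by auto
  have "aff_dim c = int (card c) - 1"
    using affine_independent_subset[OF affine_independent c(1)] by (simp add: aff_dim_affine_independent)
  then have "card c = 2" using e c by (simp add: edge_of_def aff_dim_convex_hull)
  then obtain p q where "c = {p, q}" "p \<noteq> q" by (meson card_2_iff)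
  then show "e \<in> {closed_segment A B, closed_segment B C, closed_segment C A}"
    using c by (auto simp: segment_convex_hull insert_commute)
next
  assume "e \<in> {closed_segment A B, closed_segment B C, closed_segment C A}"
  then have "\<exists>p q. {p, q} \<subseteq> {A, B, C} \<and> p \<noteq> q \<and> e = convex hull {p, q}"
    using distinct unfolding segment_convex_hull by blast
  then obtain p q where pq: "{p, q} \<subseteq> {A, B, C}" "p \<noteq> q" "e = convex hull {p, q}"
    by blast
  then have "e face_of T"
    using face_of_convex_hull_affine_independent[OF affine_independent] unfolding T_def by blast
  moreover have "aff_dim e = 1" using pq by (simp add: aff_dim_convex_hull aff_dim_2)
  ultimately show "e edge_of T" by (simp add: edge_of_def)
qed

lemma sum_edges:
  "(\<Sum>e | e edge_of T. F e) = F (closed_segment A B) + F (closed_segment B C) + F (closed_segment C A)"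
  for F :: "R2 set \<Rightarrow> real"
proof -
  have "{e. e edge_of T} = {closed_segment A B, closed_segment B C, closed_segment C A}"
    using edge_iff by auto
  then show ?thesis using distinct by (simp add: doubleton_eq_iff add.assoc)
qed

text \<open>Cramer's rule in the basis B - A, C - A.\<close>

lemma coords: "x - A = (cross2 (x - A) (C - A) / cross2 (B - A) (C - A)) *\<^sub>R (B - A)
    + (cross2 (B - A) (x - A) / cross2 (B - A) (C - A)) *\<^sub>R (C - A)"
proof -
  define d where "d = cross2 (B - A) (C - A)"
  have d: "d \<noteq> 0" using nondegenerate by (simp add: d_def)
  have "d * (x - A) $ i = cross2 (x - A) (C - A) * (B - A) $ i + cross2 (B - A) (x - A) * (C - A) $ i" for i
    using exhaust_2[of i] by (auto simp: d_def cross2_def algebra_simps)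
  then have "d *\<^sub>R (x - A) = cross2 (x - A) (C - A) *\<^sub>R (B - A) + cross2 (B - A) (x - A) *\<^sub>R (C - A)"
    by (simp add: vec_eq_iff)
  then have "(1/d) *\<^sub>R (d *\<^sub>R (x - A)) = (1/d) *\<^sub>R (cross2 (x - A) (C - A) *\<^sub>R (B - A) + cross2 (B - A) (x - A) *\<^sub>R (C - A))"
    by simp
  then show ?thesis
    using d unfolding d_def[symmetric] by (simp add: scaleR_add_right)
qed

lemma lam_polys: "lam A B C \<in> polys 1"
proof -
  have "(\<lambda>x. (1 / cross2 (B - A) (C - A)) * (cross2 B C + (C $ 1 - B $ 1) * x $ 2 + (B $ 2 - C $ 2) * x $ 1)) \<in> polys 1"
    by (intro polys_cmult polys_add polys_const polys_coord) auto
  moreover have "lam A B C = (\<lambda>x. (1 / cross2 (B - A) (C - A)) * (cross2 B C + (C $ 1 - B $ 1) * x $ 2 + (B $ 2 - C $ 2) * x $ 1))"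
    by (auto simp: lam_def cross2_def fun_eq_iff field_simps)
  ultimately show ?thesis by simp
qed

lemma lam_combination:
  assumes "x + y + z = 1"
  shows "lam A B C (x *\<^sub>R A + y *\<^sub>R B + z *\<^sub>R C) = x"
proof -
  have x: "x = 1 - y - z" using assms by simp
  have "cross2 (B - (x *\<^sub>R A + y *\<^sub>R B + z *\<^sub>R C)) (C - (x *\<^sub>R A + y *\<^sub>R B + z *\<^sub>R C)) = x * cross2 (B - A) (C - A)"
    unfolding x by (simp add: cross2_def algebra_simps)
  then show ?thesis using nondegenerate by (simp add: lam_def)
qed

lemma lam_pos: "x \<in> interior T \<Longrightarrow> 0 < lam A B C x"
  unfolding interior_T using lam_combination by auto

lemma lam_nonneg: "x \<in> T \<Longrightarrow> 0 \<le> lam A B C x"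
  unfolding T_def convex_hull_3 using lam_combination by auto

lemma lam_linepath [simp]:
  "lam A B C (linepath A B t) = 1 - t" "lam A B C (linepath B C t) = 0"
  "lam A B C (linepath B A t) = t" "lam A B C (linepath C B t) = 0"
  using lam_combination[of "1 - t" t 0] lam_combination[of 0 "1 - t" t]
    lam_combination[of t "1 - t" 0] lam_combination[of 0 t "1 - t"]
  by (simp_all add: linepath_def add.commute)

text \<open>\<open>outward_normal\<close> is a definite description, so a candidate must be
  exhibited and shown to be the only one. The second equation says that base times height is twice
  the area, with a minus sign because C lies on the inner side.\<close>

lemma normal:
  defines "n \<equiv> outward_normal T (closed_segment A B)"
  shows "n \<bullet> (B - A) = 0" "dist A B * (n \<bullet> (C - A)) = - J" "n \<bullet> (C - B) = n \<bullet> (C - A)"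
proof -
  define d where "d = cross2 (B - A) (C - A)"
  \<comment> \<open>The edge vector turned clockwise by a right angle and normalized; the sign of
    the orientation makes it point away from C.\<close>
  define \<nu> where "\<nu> = (sgn d / dist A B) *\<^sub>R pt ((B - A) $ 2) (- (B - A) $ 1)"
  let ?P = "\<lambda>n. norm n = 1 \<and> (\<forall>x\<in>closed_segment A B. \<forall>y\<in>closed_segment A B. n \<bullet> (y - x) = 0) \<and>
    (\<forall>x\<in>closed_segment A B. \<forall>y\<in>T. n \<bullet> (y - x) \<le> 0)"
  have dn: "d \<noteq> 0" using nondegenerate by (simp add: d_def)
  have AB: "dist A B > 0" using distinct by simp
  have inner: "u \<bullet> v = u $ 1 * v $ 1 + u $ 2 * v $ 2" for u v :: R2
    by (simp add: inner_vec_def UNIV_2)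
  have dAB: "dist A B ^ 2 = ((B - A) $ 1)^2 + ((B - A) $ 2)^2"
    unfolding dist_commute[of A B] unfolding dist_norm power2_norm_eq_inner inner by (simp add: power2_eq_square)
  have "pt ((B - A) $ 2) (- (B - A) $ 1) \<bullet> (B - A) = 0"
    by (simp add: inner algebra_simps)
  then have \<nu>AB: "\<nu> \<bullet> (B - A) = 0" by (simp add: \<nu>_def)
  have "pt ((B - A) $ 2) (- (B - A) $ 1) \<bullet> (C - A) = - d"
    by (simp add: d_def inner cross2_def algebra_simps)
  then have \<nu>AC: "dist A B * (\<nu> \<bullet> (C - A)) = - \<bar>d\<bar>"
    using AB by (simp add: \<nu>_def abs_sgn mult.commute)
  have seg: "\<exists>s. y - x = s *\<^sub>R (B - A)" if "x \<in> closed_segment A B" "y \<in> closed_segment A B" for x y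
  proof -
    obtain s t where st: "x = (1 - s) *\<^sub>R A + s *\<^sub>R B" "y = (1 - t) *\<^sub>R A + t *\<^sub>R B"
      using \<open>x \<in> _\<close> \<open>y \<in> _\<close> by (auto simp: closed_segment_def)
    have "y - x = (t - s) *\<^sub>R (B - A)" unfolding st by (simp add: algebra_simps)
    then show ?thesis by blast
  qed
  have "\<nu> \<bullet> (C - A) \<le> 0" using \<nu>AC AB
    by (metis abs_ge_zero mult_le_cancel_left_pos mult_zero_right neg_le_0_iff_le)
  then have out: "\<nu> \<bullet> (y - x) \<le> 0" if "x \<in> closed_segment A B" "y \<in> T" for x y
  proof -
    obtain s where "x - A = s *\<^sub>R (B - A)" using seg[OF _ \<open>x \<in> _\<close>, of A] by auto
    then have s: "x = A + s *\<^sub>R (B - A)" by (metis add.commute diff_add_cancel)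
    obtain u v where y: "y = A + u *\<^sub>R (B - A) + v *\<^sub>R (C - A)" "v \<ge> 0"
      using \<open>y \<in> T\<close> unfolding T_def convex_hull_3_alt by blast
    have "y - x = (u - s) *\<^sub>R (B - A) + v *\<^sub>R (C - A)" unfolding s y(1) by (simp add: algebra_simps)
    then have "\<nu> \<bullet> (y - x) = v * (\<nu> \<bullet> (C - A))" using \<nu>AB by (simp add: inner_add_right)
    then show ?thesis using y \<open>\<nu> \<bullet> (C - A) \<le> 0\<close> by (simp add: mult_nonneg_nonpos)
  qed
  have "norm (pt ((B - A) $ 2) (- (B - A) $ 1)) = dist A B"
    unfolding norm_eq_sqrt_inner inner by (rule real_sqrt_unique, unfold dAB) (simp_all add: power2_eq_square algebra_simps)
  then have "norm \<nu> = 1" using dn AB by (simp add: \<nu>_def abs_sgn_eq)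
  then have P\<nu>: "?P \<nu>" using out seg \<nu>AB by (metis inner_scaleR_right mult_zero_right)
  have "m = \<nu>" if m: "?P m" for m
  proof -
    have "A \<in> closed_segment A B" "B \<in> closed_segment A B" "C \<in> T"
      by (auto simp: T_def hull_inc)
    then have mAB: "m \<bullet> (B - A) = 0" and mAC: "m \<bullet> (C - A) \<le> 0" using m by blast+
    \<comment> \<open>Any competitor \<open>m\<close> is also orthogonal to B - A; \<open>l\<close>
      matches it with \<open>\<nu>\<close> on C - A, hence on the whole plane. The outward condition
      gives \<open>l \<ge> 0\<close>, and the unit norms give \<open>l = 1\<close>.\<close>
    define l where "l = (m \<bullet> (C - A)) / (\<nu> \<bullet> (C - A))"
    have nz: "\<nu> \<bullet> (C - A) \<noteq> 0" using \<nu>AC dn by auto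
    have z: "(m - l *\<^sub>R \<nu>) \<bullet> (B - A) = 0" "(m - l *\<^sub>R \<nu>) \<bullet> (C - A) = 0"
      using mAB \<nu>AB nz by (simp_all add: inner_diff_left l_def)
    have "(m - l *\<^sub>R \<nu>) \<bullet> (x - A) = 0" for x
      by (subst coords) (simp only: inner_add_right inner_scaleR_right z mult_zero_right add_0)
    from this[of "A + (m - l *\<^sub>R \<nu>)"] have "m = l *\<^sub>R \<nu>" by simp
    moreover have "l \<ge> 0" using mAC \<open>\<nu> \<bullet> (C - A) \<le> 0\<close> by (simp add: l_def divide_nonpos_nonpos)
    ultimately show "m = \<nu>" using m \<open>norm \<nu> = 1\<close> by simp
  qed
  then have n: "n = \<nu>" unfolding n_def outward_normal_def using P\<nu> by (intro the_equality) blast+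
  show "n \<bullet> (B - A) = 0" "dist A B * (n \<bullet> (C - A)) = - J"
    using \<nu>AB \<nu>AC by (simp_all add: n J_def d_def)
  then show "n \<bullet> (C - B) = n \<bullet> (C - A)" by (simp add: inner_diff_right)
qed

lemma triangle_rotate: "triangle B C A"
proof
  have "cross2 (C - B) (A - B) = cross2 (B - A) (C - A)" by (simp add: cross2_def algebra_simps)
  then show "cross2 (C - B) (A - B) \<noteq> 0" using nondegenerate by simp
qed

lemma triangle_swap: "triangle B A C"
proof
  have "cross2 (A - B) (C - B) = - cross2 (B - A) (C - A)" by (simp add: cross2_def algebra_simps)
  then show "cross2 (A - B) (C - B) \<noteq> 0" using nondegenerate by simp
qed

lemma T_rotate: "triangle.T B C A = T"
  unfolding T_def triangle.T_def[OF triangle_rotate] by (simp add: insert_commute)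

lemma T_swap: "triangle.T B A C = T"
  unfolding T_def triangle.T_def[OF triangle_swap] by (simp add: insert_commute)

lemma divergence_T:
  assumes "\<And>x. (\<psi> has_derivative \<psi>' x) (at x)" "continuous_on UNIV (\<lambda>x. \<psi>' x (B - A))"
  shows "(LINT x|lebesgue_on T. \<psi>' x (B - A))
    = J * ((LINT t|lebesgue_on {0..1}. \<psi> (linepath B C t)) - (LINT t|lebesgue_on {0..1}. \<psi> (linepath A C t)))"
  unfolding T_def J_def by (rule divergence_triangle[OF nondegenerate assms])

end

text \<open>Inside \<open>S\<close> the zero extension agrees with the smooth field on an open set.
  For a field of constant direction the divergence is the directional derivative of its scalar
  factor.\<close>

lemma divergence_restr:
  assumes "\<And>x. (\<psi> has_derivative \<psi>' x) (at x)" "x \<in> interior S"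
  shows "divergence (restr S (\<lambda>x. \<psi> x *\<^sub>R \<tau>)) x = \<psi>' x \<tau>"
proof -
  have lin: "linear (\<psi>' x)" using assms(1) has_derivative_linear by blast
  have "((\<lambda>x. \<psi> x *\<^sub>R \<tau>) has_derivative (\<lambda>h. \<psi>' x h *\<^sub>R \<tau>)) (at x)"
    using assms(1) by (rule has_derivative_scaleR_left)
  then have "(restr S (\<lambda>x. \<psi> x *\<^sub>R \<tau>) has_derivative (\<lambda>h. \<psi>' x h *\<^sub>R \<tau>)) (at x)"
    by (rule has_derivative_transform_within_open[OF _ open_interior assms(2)])
      (use interior_subset in \<open>auto simp: restr_def\<close>)
  then have "frechet_derivative (restr S (\<lambda>x. \<psi> x *\<^sub>R \<tau>)) (at x) = (\<lambda>h. \<psi>' x h *\<^sub>R \<tau>)"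
    by (rule frechet_derivative_at[symmetric])
  then have "divergence (restr S (\<lambda>x. \<psi> x *\<^sub>R \<tau>)) x = \<psi>' x (axis 1 1) * \<tau> $ 1 + \<psi>' x (axis 2 1) * \<tau> $ 2"
    by (simp add: divergence_def jacobian_def trace_def matrix_def UNIV_2)
  also have "\<dots> = \<psi>' x (\<tau> $ 1 *\<^sub>R axis 1 1 + \<tau> $ 2 *\<^sub>R axis 2 1)"
    using lin by (simp add: linear_add linear_scale)
  also have "\<tau> $ 1 *\<^sub>R axis 1 1 + \<tau> $ 2 *\<^sub>R axis 2 1 = \<tau>"
    by (simp add: vec_eq_iff forall_2 axis_def)
  finally show ?thesis .
qed

lemma simplex_triangle:
  assumes "2 simplex S"
  obtains A B C where "triangle A B C" "S = triangle.T A B C"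
proof -
  obtain V where V: "\<not> affine_dependent V" "int (card V) = 3" "S = convex hull V"
    using assms by (auto simp: simplex_def)
  then obtain A B C where ABC: "V = {A, B, C}" "A \<noteq> B" "A \<noteq> C" "B \<noteq> C"
    by (metis card_3_iff numeral_eq_iff of_nat_eq_iff of_nat_numeral)
  then have "\<not> collinear {A, B, C}" using V by (simp add: collinear_3_eq_affine_dependent)
  then have "triangle A B C" unfolding triangle_def using cross2_eq_0_imp_collinear by blast
  then show ?thesis using that[of A B C] V ABC by (simp add: triangle.T_def)
qed

section \<open>Weak functions with zero weak gradient on a triangle\<close>

lemma polys_has_derivative:
  assumes "p \<in> polys n"
  obtains p' where "\<And>x. (p has_derivative p' x) (at x)" "\<And>h. (\<lambda>x. p' x h) \<in> polys (n - 1)"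
proof -
  obtain p1 p2 where p: "p1 \<in> polys (n - 1)" "p2 \<in> polys (n - 1)"
    and d: "\<And>x. (p has_derivative (\<lambda>h. p1 x * h $ 1 + p2 x * h $ 2)) (at x)"
    using polys_derivative[OF assms] by blast
  have "(\<lambda>x. p1 x * h $ 1 + p2 x * h $ 2) \<in> polys (n - 1)" for h :: R2
    using polys_add[OF polys_cmult[OF p(1), of "h $ 1"] polys_cmult[OF p(2), of "h $ 2"]]
    by (simp add: mult.commute)
  then show ?thesis by (rule that[OF d])
qed

lemma restr_scaleR_in_Pvec:
  assumes "\<psi> \<in> polys n" shows "restr S (\<lambda>x. \<psi> x *\<^sub>R \<tau>) \<in> Pvec n S"
proof -
  have "(\<lambda>x. restr S (\<lambda>x. \<psi> x *\<^sub>R \<tau>) x $ i) = restr S (\<lambda>x. \<tau> $ i * \<psi> x)" for i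
    by (auto simp: restr_def fun_eq_iff)
  then show ?thesis
    using restr_in_Pk[OF polys_cmult[OF assms]] by (simp add: Pvec_def)
qed

text \<open>The right-hand side of the equation defining \<open>weak_gradient\<close>, as a
  functional of the test field; the weak gradient is its Riesz representative.\<close>

definition weak_functional :: "weak_fun \<Rightarrow> R2 set \<Rightarrow> (R2 \<Rightarrow> R2) \<Rightarrow> real"
  where "weak_functional v S q =
    - (LINT x|lebesgue_on S. fst v S x * divergence q x)
    + (\<Sum>e | e edge_of S. edge_integral e (\<lambda>x. snd v e x * (q x \<bullet> outward_normal S e)))"

context triangle
begin

lemma linepath_in_T:
  assumes "t \<in> {0..1}" shows "linepath A B t \<in> T" "linepath B C t \<in> T" "linepath C A t \<in> T"
proof -
  have "linepath p q t \<in> T" if "p \<in> {A, B, C}" "q \<in> {A, B, C}" for p q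
  proof -
    have "linepath p q t \<in> closed_segment p q" using assms by (simp add: linepath_in_path)
    moreover have "closed_segment p q \<subseteq> T"
      unfolding T_def using that by (intro closed_segment_subset) (auto simp: hull_inc)
    ultimately show ?thesis by blast
  qed
  then show "linepath A B t \<in> T" "linepath B C t \<in> T" "linepath C A t \<in> T" by auto
qed

definition edge_term :: "weak_fun \<Rightarrow> (R2 \<Rightarrow> real) \<Rightarrow> R2 \<Rightarrow> R2 \<Rightarrow> R2 \<Rightarrow> real"
  where "edge_term v \<psi> \<tau> P Q = dist P Q * (\<tau> \<bullet> outward_normal T (closed_segment P Q))
    * (LINT t|lebesgue_on {0..1}. snd v (closed_segment P Q) (linepath P Q t) * \<psi> (linepath P Q t))"

lemma weak_functional_directional:
  assumes \<psi>: "\<And>x. (\<psi> has_derivative \<psi>' x) (at x)" and c: "continuous_on T (\<lambda>x. \<psi>' x \<tau>)"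
    and v: "fst v T = restr T p" and p: "p \<in> polys k"
  shows "weak_functional v T (restr T (\<lambda>x. \<psi> x *\<^sub>R \<tau>))
    = - (LINT x|lebesgue_on T. p x * \<psi>' x \<tau>)
    + (edge_term v \<psi> \<tau> A B + edge_term v \<psi> \<tau> B C + edge_term v \<psi> \<tau> C A)"
proof -
  have T: "T \<in> sets lebesgue" using compact_T compact_imp_sets_lebesgue by blast
  have int: "integrable (lebesgue_on T) (\<lambda>x. p x * \<psi>' x \<tau>)"
    using polys_continuous[OF p] c by (intro integrable_compact compact_T continuous_on_mult)
  have "(LINT x|lebesgue_on T. fst v T x * divergence (restr T (\<lambda>x. \<psi> x *\<^sub>R \<tau>)) x) = (LINT x|lebesgue_on T. p x * \<psi>' x \<tau>)"
    using divergence_restr[OF \<psi>] by (intro integral_lebesgue_on_spike[OF T negligible_boundary _ int]) (auto simp: v restr_def)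
  moreover have "edge_integral (closed_segment P Q) (\<lambda>x. snd v (closed_segment P Q) x * (restr T (\<lambda>x. \<psi> x *\<^sub>R \<tau>) x \<bullet> outward_normal T (closed_segment P Q)))
    = edge_term v \<psi> \<tau> P Q" if "\<And>t. t \<in> {0..1} \<Longrightarrow> linepath P Q t \<in> T" for P Q
  proof -
    define e where "e = closed_segment P Q"
    have "(LINT t|lebesgue_on {0..1}. snd v e (linepath P Q t) * (restr T (\<lambda>x. \<psi> x *\<^sub>R \<tau>) (linepath P Q t) \<bullet> outward_normal T e))
      = (LINT t|lebesgue_on {0..1}. (\<tau> \<bullet> outward_normal T e) * (snd v e (linepath P Q t) * \<psi> (linepath P Q t)))"
      using that by (intro Bochner_Integration.integral_cong) (auto simp: restr_def)
    then show ?thesis unfolding e_def edge_integral_segment edge_term_def by simp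
  qed
  ultimately show ?thesis
    unfolding weak_functional_def sum_edges using linepath_in_T by simp
qed

lemma edge_term_zero:
  assumes "\<And>t. \<psi> (linepath P Q t) = 0"
  shows "edge_term v \<psi> \<tau> P Q = 0"
  using assms by (simp add: edge_term_def)

lemma tangential_derivative_zero:
  assumes k: "k \<ge> 1" and v: "fst v T = restr T p" and p: "p \<in> polys k"
    and p': "\<And>x. (p has_derivative p' x) (at x)" "\<And>h. (\<lambda>x. p' x h) \<in> polys (k - 1)"
    and zero: "\<And>q. q \<in> Pvec (k + 1) T \<Longrightarrow> weak_functional v T q = 0"
    and x: "x \<in> T"
  shows "p' x (B - A) = 0"
proof -
  interpret S: triangle B A C by (rule triangle_swap)
  define \<tau> where "\<tau> = B - A"
  define d where "d = (\<lambda>x. p' x \<tau>)"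
  define \<psi> where "\<psi> = (\<lambda>x. lam A B C x * lam B A C x * d x)"
  have d: "d \<in> polys (k - 1)" using p'(2) by (simp add: d_def)
  have "\<psi> \<in> polys (1 + 1 + (k - 1))"
    unfolding \<psi>_def by (intro polys_mult lam_polys S.lam_polys d)
  \<comment> \<open>By \<open>k \<ge> 1\<close> the truncated difference k - 1 is exact, so the
    degree is k + 1.\<close>
  then have \<psi>: "\<psi> \<in> polys (k + 1)" using k by simp
  obtain \<psi>' where \<psi>': "\<And>x. (\<psi> has_derivative \<psi>' x) (at x)" "\<And>h. (\<lambda>x. \<psi>' x h) \<in> polys (k + 1 - 1)"
    using polys_has_derivative[OF \<psi>] by blast
  have "edge_term v \<psi> \<tau> A B = 0"
    using normal(1) by (simp add: edge_term_def \<tau>_def inner_commute)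
  moreover have "edge_term v \<psi> \<tau> B C = 0" "edge_term v \<psi> \<tau> C A = 0"
    by (rule edge_term_zero, simp add: \<psi>_def)+
  ultimately have 1: "(LINT x|lebesgue_on T. p x * \<psi>' x \<tau>) = 0"
    using weak_functional_directional[OF \<psi>'(1) polys_continuous[OF \<psi>'(2)] v p, of \<tau>]
      zero[OF restr_scaleR_in_Pvec[OF \<psi>], of \<tau>] by simp
  note cont = polys_continuous[OF p] polys_continuous[OF \<psi>] polys_continuous[OF \<psi>'(2)] polys_continuous[OF p'(2)]
  \<comment> \<open>Integration by parts: the flux of \<open>p \<psi> \<tau>\<close> vanishes,
    because \<open>\<tau>\<close> is tangential on AB and \<open>\<psi>\<close> is zero on the other
    two edges.\<close>
  have "((\<lambda>x. p x * \<psi> x) has_derivative (\<lambda>h. p x * \<psi>' x h + p' x h * \<psi> x)) (at x)" for x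
    by (rule has_derivative_mult[OF p'(1) \<psi>'(1)])
  then have "(LINT x|lebesgue_on T. p x * \<psi>' x \<tau> + p' x \<tau> * \<psi> x)
    = J * ((LINT t|lebesgue_on {0..1}. p (linepath B C t) * \<psi> (linepath B C t))
      - (LINT t|lebesgue_on {0..1}. p (linepath A C t) * \<psi> (linepath A C t)))"
    unfolding \<tau>_def using cont by (intro divergence_T[where \<psi>'="\<lambda>x h. p x * \<psi>' x h + p' x h * \<psi> x"] continuous_intros)
  also have "\<dots> = 0" by (simp add: \<psi>_def)
  finally have "(LINT x|lebesgue_on T. p x * \<psi>' x \<tau> + p' x \<tau> * \<psi> x) = 0" .
  moreover have "(LINT x|lebesgue_on T. p x * \<psi>' x \<tau> + p' x \<tau> * \<psi> x)
    = (LINT x|lebesgue_on T. p x * \<psi>' x \<tau>) + (LINT x|lebesgue_on T. p' x \<tau> * \<psi> x)"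
    using cont by (intro Bochner_Integration.integral_add integrable_compact compact_T continuous_intros)
  ultimately have 2: "(LINT x|lebesgue_on T. lam A B C x * lam B A C x * (d x)\<^sup>2) = 0"
    using 1 by (simp add: \<psi>_def d_def power2_eq_square algebra_simps)
  have lamB: "0 \<le> lam B A C x" if "x \<in> T" for x
    using S.lam_nonneg that T_swap by simp
  have lamBpos: "0 < lam B A C x" if "x \<in> interior T" for x
    using S.lam_pos that T_swap by simp
  have "lam A B C x * lam B A C x * (d x)\<^sup>2 = 0" if "x \<in> T" for x
    by (rule integral_0_convex_imp_0[OF compact_T convex_T interior_nonempty _ _ 2 that])
      (auto intro!: continuous_intros polys_continuous[OF lam_polys] polys_continuous[OF S.lam_polys]
        polys_continuous[OF d] mult_nonneg_nonneg lam_nonneg lamB)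
  \<comment> \<open>The barycentric weights are surely positive only inside; the boundary of
    \<open>T\<close> is reached by continuity.\<close>
  then have "d x = 0" if "x \<in> interior T" for x
    using lam_pos[OF that] lamBpos[OF that] that interior_subset by fastforce
  moreover have "closure (interior T) = T"
    using convex_closure_interior[OF convex_T interior_nonempty] compact_T by (simp add: compact_imp_closed closure_closed)
  ultimately have "d x = 0"
    using continuous_constant_on_closure[OF polys_continuous[OF d], of "interior T" 0 x] x by auto
  then show ?thesis by (simp add: d_def \<tau>_def)
qed

text \<open>The directions of two edges, AB and CA, span the plane, so the whole derivative of
  \<open>p\<close> vanishes on the convex set \<open>T\<close>.\<close>

lemma interior_part_constant:
  assumes k: "k \<ge> 1" and v: "fst v T \<in> Pk k T"
    and zero: "\<And>q. q \<in> Pvec (k + 1) T \<Longrightarrow> weak_functional v T q = 0"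
  shows "\<exists>c. fst v T = restr T (\<lambda>_. c)"
proof -
  obtain p where p: "p \<in> polys k" "fst v T = restr T p" using v by (rule PkE)
  obtain p' where p': "\<And>x. (p has_derivative p' x) (at x)" "\<And>h. (\<lambda>x. p' x h) \<in> polys (k - 1)"
    using polys_has_derivative[OF p(1)] by blast
  interpret R: triangle B C A by (rule triangle_rotate)
  interpret R': triangle C A B by (rule R.triangle_rotate)
  have RT: "R'.T = T" using R.T_rotate T_rotate by simp
  have "p' x h = 0" if x: "x \<in> T" for x h
  proof -
    have lin: "linear (p' x)" using p'(1) has_derivative_linear by blast
    have "p' x (B - A) = 0"
      by (rule tangential_derivative_zero[OF k p(2) p(1) p' zero x])
    moreover have "p' x (A - C) = 0"
      by (rule R'.tangential_derivative_zero[where v=v and p=p and k=k]) (use k p p' zero x RT in auto)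
    then have "p' x (C - A) = 0" using linear_neg[OF lin, of "A - C"] by simp
    ultimately have *: "p' x (a *\<^sub>R (B - A) + b *\<^sub>R (C - A)) = 0" for a b
      using lin by (simp only: linear_add linear_scale) simp
    have "h = (A + h) - A" by simp
    then show ?thesis using coords[of "A + h"] * by metis
  qed
  then have "(p has_derivative (\<lambda>h. 0)) (at x within T)" if "x \<in> T" for x
  proof -
    have "p' x = (\<lambda>h. 0)" using \<open>\<And>x h. x \<in> T \<Longrightarrow> p' x h = 0\<close>[OF that] by blast
    then show ?thesis using has_derivative_at_withinI[OF p'(1)[of x], of T] by simp
  qed
  then obtain c where "\<And>x. x \<in> T \<Longrightarrow> p x = c"
    using has_derivative_zero_constant[OF convex_T] by metis
  then show ?thesis unfolding p(2) by (intro exI[of _ c]) (auto simp: restr_def)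
qed

text \<open>The test field is \<open>lam A B C * m\<close> times C - A: the factor vanishes on BC,
  the direction is tangential on CA. Since \<open>v\<^sub>0\<close> is the constant
  \<open>c\<close>, the divergence theorem turns the volume term into the flux through AB with
  \<open>c\<close> in place of \<open>v\<^sub>b\<close>.\<close>

lemma boundary_moment_zero:
  assumes v: "fst v T = restr T (\<lambda>_. c)" and vb: "continuous_on (closed_segment A B) (snd v (closed_segment A B))"
    and m: "m \<in> polys k"
    and zero: "\<And>q. q \<in> Pvec (k + 1) T \<Longrightarrow> weak_functional v T q = 0"
  shows "(LINT t|lebesgue_on {0..1}. (snd v (closed_segment A B) (linepath A B t) - c)
    * (lam A B C (linepath A B t) * m (linepath A B t))) = 0"
proof -
  interpret R: triangle B C A by (rule triangle_rotate)
  interpret R': triangle C A B by (rule R.triangle_rotate)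
  interpret S: triangle B A C by (rule triangle_swap)
  interpret S': triangle A C B by (rule S.triangle_rotate)
  have R'T: "R'.T = T" using R.T_rotate T_rotate by simp
  have S'T: "S'.T = T" using S.T_rotate T_swap by simp
  have S'J: "S'.J = J" unfolding J_def S'.J_def by (simp add: cross2_def algebra_simps)
  define \<psi> where "\<psi> = (\<lambda>x. lam A B C x * m x)"
  define \<tau> where "\<tau> = C - A"
  define vb where "vb = snd v (closed_segment A B)"
  have "\<psi> \<in> polys (1 + k)" unfolding \<psi>_def by (intro polys_mult lam_polys m)
  then have \<psi>: "\<psi> \<in> polys (k + 1)" by simp
  obtain \<psi>' where \<psi>': "\<And>x. (\<psi> has_derivative \<psi>' x) (at x)" "\<And>h. (\<lambda>x. \<psi>' x h) \<in> polys (k + 1 - 1)"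
    using polys_has_derivative[OF \<psi>] by blast
  have "edge_term v \<psi> \<tau> B C = 0"
    by (rule edge_term_zero) (simp add: \<psi>_def)
  moreover have "edge_term v \<psi> \<tau> C A = 0"
  proof -
    have "outward_normal T (closed_segment C A) \<bullet> (C - A) = 0"
      using R'.normal(1) R'T by (simp add: inner_diff_right)
    then show ?thesis by (simp add: edge_term_def \<tau>_def inner_commute)
  qed
  moreover have "edge_term v \<psi> \<tau> A B = - J * (LINT t|lebesgue_on {0..1}. vb (linepath A B t) * \<psi> (linepath A B t))"
    using normal(2) by (simp add: edge_term_def \<tau>_def vb_def inner_commute)
  moreover have "(LINT x|lebesgue_on T. c * \<psi>' x \<tau>) = - J * (LINT t|lebesgue_on {0..1}. c * \<psi> (linepath A B t))"
    using S'.divergence_T[OF \<psi>'(1) polys_continuous[OF \<psi>'(2)]] unfolding S'T S'J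
    by (simp add: \<tau>_def \<psi>_def)
  ultimately have "J * (LINT t|lebesgue_on {0..1}. c * \<psi> (linepath A B t)) = J * (LINT t|lebesgue_on {0..1}. vb (linepath A B t) * \<psi> (linepath A B t))"
    using weak_functional_directional[OF \<psi>'(1) polys_continuous[OF \<psi>'(2)] v polys_const, of \<tau>]
      zero[OF restr_scaleR_in_Pvec[OF \<psi>], of \<tau>] by simp
  then have eq: "(LINT t|lebesgue_on {0..1}. vb (linepath A B t) * \<psi> (linepath A B t)) = (LINT t|lebesgue_on {0..1}. c * \<psi> (linepath A B t))"
    using J_pos by simp
  have l: "continuous_on {0..1} (linepath A B)" by (rule continuous_on_linepath)
  have "continuous_on {0..1} (\<lambda>t. vb (linepath A B t))" "continuous_on {0..1} (\<lambda>t. \<psi> (linepath A B t))"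
    using continuous_on_compose2[OF assms(2) l] continuous_on_compose2[OF polys_continuous[OF \<psi>] l]
    by (auto simp: vb_def linepath_image_01)
  then have "(LINT t|lebesgue_on {0..1}. vb (linepath A B t) * \<psi> (linepath A B t) - c * \<psi> (linepath A B t)) = 0"
    using eq by (subst Bochner_Integration.integral_diff) (auto intro!: integrable_compact continuous_intros)
  then show ?thesis by (simp add: vb_def \<psi>_def left_diff_distrib)
qed

end

text \<open>On the edge each coordinate is (1 - t) times its value at A plus t times its value at B.
  Splitting off one coordinate factor settles monomials of top degree; for lower degrees, 1 = (1 -
  t) + t suffices.\<close>

lemma polys_split_edge:
  assumes "W \<in> polys (k + 1)"
  shows "\<exists>m\<in>polys k. \<exists>m'\<in>polys k. \<forall>t. W (linepath A B t) = (1 - t) * m (linepath A B t) + t * m' (linepath A B t)"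
  using assms
proof (induction rule: polys_induct)
  case (mono i j)
  consider "i + j \<le> k" | "i + j = k + 1" "i > 0" | "i + j = k + 1" "j > 0" using mono by linarith
  then show ?case
  proof cases
    case 1
    then show ?thesis
      by (intro bexI[of _ "mono2 i j"] mono2_in_polys) (auto simp: algebra_simps)
  next
    case 2
    then have "mono2 (i - 1) j \<in> polys k" by (intro mono2_in_polys) auto
    moreover have "mono2 i j x = x $ 1 * mono2 (i - 1) j x" for x
      using 2 by (simp add: mono2_def power_eq_if)
    ultimately show ?thesis
      by (intro bexI[of _ "\<lambda>x. A $ 1 * mono2 (i - 1) j x"] bexI[of _ "\<lambda>x. B $ 1 * mono2 (i - 1) j x"] polys_cmult)
        (simp_all add: linepath_def algebra_simps)
  next
    case 3
    then have "mono2 i (j - 1) \<in> polys k" by (intro mono2_in_polys) auto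
    moreover have "mono2 i j x = x $ 2 * mono2 i (j - 1) x" for x
      using 3 by (simp add: mono2_def power_eq_if)
    ultimately show ?thesis
      by (intro bexI[of _ "\<lambda>x. A $ 2 * mono2 i (j - 1) x"] bexI[of _ "\<lambda>x. B $ 2 * mono2 i (j - 1) x"] polys_cmult)
        (simp_all add: linepath_def algebra_simps)
  qed
next
  case (add p q)
  then obtain m1 m1' m2 m2' where m: "m1 \<in> polys k" "m1' \<in> polys k" "m2 \<in> polys k" "m2' \<in> polys k"
    "\<And>t. p (linepath A B t) = (1 - t) * m1 (linepath A B t) + t * m1' (linepath A B t)"
    "\<And>t. q (linepath A B t) = (1 - t) * m2 (linepath A B t) + t * m2' (linepath A B t)"
    by blast
  then show ?case
    by (intro bexI[of _ "\<lambda>x. m1 x + m2 x"] bexI[of _ "\<lambda>x. m1' x + m2' x"] polys_add)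
      (simp_all add: algebra_simps)
next
  case (scale c p)
  then obtain m m' where m: "m \<in> polys k" "m' \<in> polys k"
    "\<And>t. p (linepath A B t) = (1 - t) * m (linepath A B t) + t * m' (linepath A B t)"
    by blast
  then show ?case
    by (intro bexI[OF bexI[OF _ polys_cmult[OF m(2), of c]] polys_cmult[OF m(1), of c]])
      (simp add: m(3) distrib_left mult.left_commute)
qed

context triangle
begin

text \<open>The error \<open>w = v\<^sub>b - c\<close> is itself split by
  \<open>polys_split_edge\<close>; testing with its own two factors makes the vanishing moments add
  up to the integral of \<open>w\<^sup>2\<close>.\<close>

lemma boundary_part_constant:
  assumes v: "fst v T = restr T (\<lambda>_. c)" and vb: "snd v (closed_segment A B) \<in> Pk (k + 1) (closed_segment A B)"
    and zero: "\<And>q. q \<in> Pvec (k + 1) T \<Longrightarrow> weak_functional v T q = 0"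
    and x: "x \<in> closed_segment A B"
  shows "snd v (closed_segment A B) x = c"
proof -
  interpret S: triangle B A C by (rule triangle_swap)
  define w where "w = (\<lambda>t. snd v (closed_segment A B) (linepath A B t) - c)"
  obtain V where V: "V \<in> polys (k + 1)" "snd v (closed_segment A B) = restr (closed_segment A B) V"
    using vb by (rule PkE)
  have c: "continuous_on (closed_segment A B) (snd v (closed_segment A B))"
    using Pk_continuous[OF vb] .
  have l: "continuous_on {0..1} (linepath A B)" by (rule continuous_on_linepath)
  have cp: "continuous_on {0..1} (\<lambda>t. m (linepath A B t))" if "m \<in> polys n" for m n
    using continuous_on_compose2[OF polys_continuous[OF that] l] by auto
  obtain m m' where m: "m \<in> polys k" "m' \<in> polys k"
    "\<And>t. V (linepath A B t) - c = (1 - t) * m (linepath A B t) + t * m' (linepath A B t)"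
    using polys_split_edge[OF polys_diff[OF V(1) polys_const[of c]], of A B] by blast
  have w: "w t = (1 - t) * m (linepath A B t) + t * m' (linepath A B t)" if "t \<in> {0..1}" for t
    using m(3)[of t] that by (simp add: w_def V(2) restr_def linepath_in_path)
  have "linepath A B ` {0..1} \<subseteq> closed_segment A B" by (simp add: linepath_image_01)
  then have cw: "continuous_on {0..1} w"
    unfolding w_def by (intro continuous_on_diff continuous_on_compose2[OF c l] continuous_on_const)
  have 1: "(LINT t|lebesgue_on {0..1}. w t * ((1 - t) * m (linepath A B t))) = 0"
    using boundary_moment_zero[OF v c m(1) zero] by (simp add: w_def)
  \<comment> \<open>The swapped triangle supplies the moment with the barycentric coordinate of B,
    along the edge traversed backwards.\<close>
  have "(LINT t|lebesgue_on {0..1}. (snd v (closed_segment B A) (linepath B A t) - c)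
    * (lam B A C (linepath B A t) * m' (linepath B A t))) = 0"
    by (rule S.boundary_moment_zero[where k=k])
      (use v c m(2) zero T_swap in \<open>auto simp: closed_segment_commute\<close>)
  then have 2: "(LINT t|lebesgue_on {0..1}. w t * (t * m' (linepath A B t))) = 0"
    using integral_linepath_commute[of "\<lambda>x. (snd v (closed_segment A B) x - c) * (lam B A C x * m' x)" A B]
    by (simp add: w_def closed_segment_commute[of B A])
  have "(LINT t|lebesgue_on {0..1}. (w t)\<^sup>2)
    = (LINT t|lebesgue_on {0..1}. w t * ((1 - t) * m (linepath A B t)) + w t * (t * m' (linepath A B t)))"
    using w by (intro Bochner_Integration.integral_cong) (simp_all add: power2_eq_square distrib_left[symmetric])
  also have "\<dots> = 0"
    using 1 2 cw cp[OF m(1)] cp[OF m(2)]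
    by (subst Bochner_Integration.integral_add) (auto intro!: integrable_compact continuous_intros)
  finally have int: "(LINT t|lebesgue_on {0..1}. (w t)\<^sup>2) = 0" .
  obtain t where t: "t \<in> {0..1}" "x = linepath A B t"
    using x by (auto simp: closed_segment_def linepath_def)
  have "(w t)\<^sup>2 = 0"
    using cw by (intro integral_0_convex_imp_0[OF _ _ _ _ _ int t(1)]) (auto intro!: continuous_intros)
  then show ?thesis using t by (simp add: w_def)
qed

lemma weak_functional_zero_imp_constant:
  assumes k: "k \<ge> 1" and v: "fst v T \<in> Pk k T"
    and vb: "\<And>e. e edge_of T \<Longrightarrow> snd v e \<in> Pk (k + 1) e"
    and zero: "\<And>q. q \<in> Pvec (k + 1) T \<Longrightarrow> weak_functional v T q = 0"
  shows "\<exists>c. (\<forall>x\<in>T. fst v T x = c) \<and> (\<forall>e. e edge_of T \<longrightarrow> (\<forall>x\<in>e. snd v e x = c))"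
proof -
  interpret R: triangle B C A by (rule triangle_rotate)
  interpret R': triangle C A B by (rule R.triangle_rotate)
  have RT: "R.T = T" "R'.T = T" using R.T_rotate T_rotate by auto
  obtain c where c: "fst v T = restr T (\<lambda>_. c)"
    using interior_part_constant[OF k v zero] by blast
  have "snd v e x = c" if e: "e edge_of T" "x \<in> e" for e x
  proof -
    consider "e = closed_segment A B" | "e = closed_segment B C" | "e = closed_segment C A"
      using edge_iff[THEN iffD1, OF e(1)] by auto
    then show ?thesis
    proof cases
      case 1
      then show ?thesis using boundary_part_constant[of v c k x] c vb zero e by auto
    next
      case 2
      then show ?thesis using R.boundary_part_constant[of v c k x] c vb zero e RT by auto
    next
      case 3
      then show ?thesis using R'.boundary_part_constant[of v c k x] c vb zero e RT by auto
    qed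
  qed
  then show ?thesis using c by (intro exI[of _ c]) (auto simp: restr_def)
qed

end

section \<open>Existence and linearity of the weak gradient\<close>

lemma
  fixes S :: "R2 set"
  assumes "2 simplex S"
  shows compact_simplex2: "compact S" and convex_simplex2: "convex S"
    and interior_simplex2: "interior S \<noteq> {}" and negligible_simplex2: "negligible (S - interior S)"
    and finite_edges_simplex2: "finite {e. e edge_of S}"
proof -
  obtain A B C where tri: "triangle A B C" and S: "S = triangle.T A B C"
    using simplex_triangle[OF assms] by blast
  interpret triangle A B C by (rule tri)
  show "compact S" "convex S" "interior S \<noteq> {}" "negligible (S - interior S)"
    unfolding S by (rule compact_T convex_T interior_nonempty negligible_boundary)+
  have "{e. e edge_of S} = {closed_segment A B, closed_segment B C, closed_segment C A}"
    unfolding S using edge_iff by auto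
  then show "finite {e. e edge_of S}" by simp
qed

lemma edge_of_simplex2:
  fixes S :: "R2 set"
  assumes "2 simplex S" "e edge_of S"
  obtains P Q where "P \<noteq> Q" "e = closed_segment P Q"
proof -
  obtain A B C where tri: "triangle A B C" and S: "S = triangle.T A B C"
    using simplex_triangle[OF assms(1)] by blast
  interpret triangle A B C by (rule tri)
  have "e \<in> {closed_segment A B, closed_segment B C, closed_segment C A}"
    using assms(2) unfolding S edge_iff .
  then show thesis using that distinct by auto
qed

lemma divergence_eq:
  assumes "(q has_derivative q') (at x)"
  shows "divergence q x = q' (axis 1 1) $ 1 + q' (axis 2 1) $ 2"
  using frechet_derivative_at[OF assms]
  by (simp add: divergence_def jacobian_def trace_def matrix_def UNIV_2)

text \<open>The derivative is claimed only inside \<open>S\<close>, but its components are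
  polynomials on the whole plane. Thus the divergence agrees off a null set with a continuous
  function, which gives integrability.\<close>

lemma Pvec_has_derivative:
  assumes "q \<in> Pvec n S"
  obtains q' where "\<And>x. x \<in> interior S \<Longrightarrow> (q has_derivative q' x) (at x)"
    "\<And>h i. (\<lambda>x. q' x h $ i) \<in> polys (n - 1)"
proof -
  obtain p r where pr: "p \<in> polys n" "r \<in> polys n" "q = restr S (\<lambda>x. vector [p x, r x])"
    using assms by (auto simp: Pvec_eq)
  obtain p' where p': "\<And>x. (p has_derivative p' x) (at x)" "\<And>h. (\<lambda>x. p' x h) \<in> polys (n - 1)"
    using polys_has_derivative[OF pr(1)] by blast
  obtain r' where r': "\<And>x. (r has_derivative r' x) (at x)" "\<And>h. (\<lambda>x. r' x h) \<in> polys (n - 1)"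
    using polys_has_derivative[OF pr(2)] by blast
  have d: "(q has_derivative (\<lambda>h. p' x h *\<^sub>R axis 1 1 + r' x h *\<^sub>R axis 2 1)) (at x)" if "x \<in> interior S" for x
  proof -
    have "((\<lambda>x. p x *\<^sub>R axis 1 1 + r x *\<^sub>R axis 2 1) has_derivative (\<lambda>h. p' x h *\<^sub>R axis 1 1 + r' x h *\<^sub>R axis 2 1)) (at x)"
      by (intro has_derivative_add has_derivative_scaleR_left p' r')
    then show ?thesis
      by (rule has_derivative_transform_within_open[OF _ open_interior that])
        (use interior_subset in \<open>auto simp: pr(3) restr_def vec_eq_iff forall_2 axis_def\<close>)
  qed
  have "(\<lambda>x. (p' x h *\<^sub>R axis 1 1 + r' x h *\<^sub>R axis 2 1 :: R2) $ i) \<in> polys (n - 1)" for h and i :: 2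
    using p'(2)[of h] r'(2)[of h] exhaust_2[of i] by (auto simp: axis_def)
  from that[OF d this] show thesis .
qed

lemma divergence_add:
  assumes "q \<in> Pvec n S" "r \<in> Pvec n S" "x \<in> interior S"
  shows "divergence (q + r) x = divergence q x + divergence r x"
proof -
  obtain q' where q': "(q has_derivative q' x) (at x)" using Pvec_has_derivative[OF assms(1)] assms(3) by metis
  obtain r' where r': "(r has_derivative r' x) (at x)" using Pvec_has_derivative[OF assms(2)] assms(3) by metis
  show ?thesis
    using has_derivative_add[OF q' r'] divergence_eq[OF q'] divergence_eq[OF r']
    by (simp add: plus_fun_def divergence_eq)
qed

lemma divergence_scale:
  assumes "q \<in> Pvec n S" "x \<in> interior S"
  shows "divergence (c *\<^sub>R q) x = c * divergence q x"
proof -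
  obtain q' where q': "(q has_derivative q' x) (at x)" using Pvec_has_derivative[OF assms(1)] assms(2) by metis
  show ?thesis
    using has_derivative_scaleR_right[OF q', of c] divergence_eq[OF q']
    by (simp add: scaleR_fun_def divergence_eq distrib_left)
qed

text \<open>Keeps just the components that \<open>weak_gradient\<close> on \<open>S\<close> looks
  at, so that its properties are proved without a mesh.\<close>

definition local_weak :: "nat \<Rightarrow> R2 set \<Rightarrow> weak_fun set"
  where "local_weak k S = {v. fst v S \<in> Pk k S \<and> (\<forall>e. e edge_of S \<longrightarrow> snd v e \<in> Pk (k + 1) e)}"

lemma subspace_local_weak: "subspace (local_weak k S)"
  using subspace_Pk unfolding local_weak_def subspace_def by auto

lemma integrable_div_term:
  assumes S: "2 simplex S" and v: "v \<in> local_weak k S" and q: "q \<in> Pvec n S"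
  shows "integrable (lebesgue_on S) (\<lambda>x. fst v S x * divergence q x)"
proof -
  obtain q' where q': "\<And>x. x \<in> interior S \<Longrightarrow> (q has_derivative q' x) (at x)"
    "\<And>h i. (\<lambda>x. q' x h $ i) \<in> polys (n - 1)"
    using Pvec_has_derivative[OF q] by metis
  have "continuous_on S (fst v S)" using v Pk_continuous by (auto simp: local_weak_def)
  then have "integrable (lebesgue_on S) (\<lambda>x. fst v S x * (q' x (axis 1 1) $ 1 + q' x (axis 2 1) $ 2))"
    using polys_continuous[OF q'(2)] compact_simplex2[OF S] by (intro integrable_compact continuous_on_mult continuous_on_add)
  then show ?thesis
    by (rule integrable_lebesgue_on_spike[OF compact_imp_sets_lebesgue[OF compact_simplex2[OF S]] negligible_simplex2[OF S], rotated])
      (use divergence_eq[OF q'(1)] in auto)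
qed

lemma edge_term_continuous:
  assumes "e edge_of S" "v \<in> local_weak k S" "q \<in> Pvec n S"
  shows "continuous_on e (\<lambda>x. snd v e x * (q x \<bullet> n'))"
proof -
  have "continuous_on e (snd v e)" using assms Pk_continuous by (auto simp: local_weak_def)
  moreover have "continuous_on e q"
    using continuous_on_subset[OF Pvec_continuous[OF assms(3)] edge_of_imp_subset[OF assms(1)]] .
  ultimately show ?thesis by (intro continuous_intros)
qed

lemma integrable_linepath:
  fixes \<phi> :: "R2 \<Rightarrow> real"
  assumes "continuous_on (closed_segment P Q) \<phi>"
  shows "integrable (lebesgue_on {0..1}) (\<lambda>t. \<phi> (linepath P Q t))"
  using continuous_on_compose2[OF assms continuous_on_linepath[of "{0..1}" P Q]]
  by (intro integrable_compact) (auto simp: linepath_image_01)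

lemma edge_integral_add:
  assumes "continuous_on (closed_segment P Q) \<phi>" "continuous_on (closed_segment P Q) \<psi>"
  shows "edge_integral (closed_segment P Q) (\<lambda>x. \<phi> x + \<psi> x)
    = edge_integral (closed_segment P Q) \<phi> + edge_integral (closed_segment P Q) \<psi>"
  unfolding edge_integral_segment
  by (subst Bochner_Integration.integral_add[OF integrable_linepath[OF assms(1)] integrable_linepath[OF assms(2)]])
    (simp add: distrib_left)

lemma edge_integral_cmult:
  "edge_integral (closed_segment P Q) (\<lambda>x. c * \<phi> x) = c * edge_integral (closed_segment P Q) \<phi>"
  unfolding edge_integral_segment by simp

lemma weak_functional_add_right:
  assumes S: "2 simplex S" and v: "v \<in> local_weak k S" and q: "q \<in> Pvec n S" and r: "r \<in> Pvec n S"
  shows "weak_functional v S (q + r) = weak_functional v S q + weak_functional v S r"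
proof -
  have "(LINT x|lebesgue_on S. fst v S x * divergence (q + r) x)
    = (LINT x|lebesgue_on S. fst v S x * divergence q x + fst v S x * divergence r x)"
    by (rule integral_lebesgue_on_spike[OF compact_imp_sets_lebesgue[OF compact_simplex2[OF S]] negligible_simplex2[OF S]])
      (use integrable_div_term[OF S v q] integrable_div_term[OF S v r] divergence_add[OF q r] in \<open>auto simp: distrib_left\<close>)
  also have "\<dots> = (LINT x|lebesgue_on S. fst v S x * divergence q x) + (LINT x|lebesgue_on S. fst v S x * divergence r x)"
    by (rule Bochner_Integration.integral_add[OF integrable_div_term[OF S v q] integrable_div_term[OF S v r]])
  finally have 1: "(LINT x|lebesgue_on S. fst v S x * divergence (q + r) x) = \<dots>" .
  have 2: "edge_integral e (\<lambda>x. snd v e x * ((q + r) x \<bullet> outward_normal S e))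
    = edge_integral e (\<lambda>x. snd v e x * (q x \<bullet> outward_normal S e)) + edge_integral e (\<lambda>x. snd v e x * (r x \<bullet> outward_normal S e))"
    if ed: "e edge_of S" for e
  proof -
    obtain P Q where e: "e = closed_segment P Q" using edge_of_simplex2[OF S ed] by blast
    show ?thesis
      using edge_integral_add[OF edge_term_continuous[OF ed v q, unfolded e] edge_term_continuous[OF ed v r, unfolded e]]
      by (simp add: e inner_add_left distrib_left)
  qed
  have 3: "(\<Sum>e | e edge_of S. edge_integral e (\<lambda>x. snd v e x * ((q + r) x \<bullet> outward_normal S e)))
    = (\<Sum>e | e edge_of S. edge_integral e (\<lambda>x. snd v e x * (q x \<bullet> outward_normal S e)) + edge_integral e (\<lambda>x. snd v e x * (r x \<bullet> outward_normal S e)))"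
    by (rule sum.cong) (use 2 in auto)
  show ?thesis unfolding weak_functional_def 1 3 sum.distrib by simp
qed

lemma weak_functional_scale_right:
  assumes S: "2 simplex S" and v: "v \<in> local_weak k S" and q: "q \<in> Pvec n S"
  shows "weak_functional v S (c *\<^sub>R q) = c * weak_functional v S q"
proof -
  have "(LINT x|lebesgue_on S. fst v S x * divergence (c *\<^sub>R q) x)
    = (LINT x|lebesgue_on S. c * (fst v S x * divergence q x))"
    by (rule integral_lebesgue_on_spike[OF compact_imp_sets_lebesgue[OF compact_simplex2[OF S]] negligible_simplex2[OF S]])
      (use integrable_div_term[OF S v q] divergence_scale[OF q] in auto)
  then have 1: "(LINT x|lebesgue_on S. fst v S x * divergence (c *\<^sub>R q) x) = c * (LINT x|lebesgue_on S. fst v S x * divergence q x)"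
    by simp
  have 2: "edge_integral e (\<lambda>x. snd v e x * ((c *\<^sub>R q) x \<bullet> outward_normal S e))
    = c * edge_integral e (\<lambda>x. snd v e x * (q x \<bullet> outward_normal S e))" if ed: "e edge_of S" for e
  proof -
    obtain P Q where e: "e = closed_segment P Q" using edge_of_simplex2[OF S ed] by blast
    show ?thesis unfolding e edge_integral_cmult[symmetric] by (simp add: mult.left_commute)
  qed
  have 3: "(\<Sum>e | e edge_of S. edge_integral e (\<lambda>x. snd v e x * ((c *\<^sub>R q) x \<bullet> outward_normal S e)))
    = (\<Sum>e | e edge_of S. c * edge_integral e (\<lambda>x. snd v e x * (q x \<bullet> outward_normal S e)))"
    by (rule sum.cong) (use 2 in auto)
  show ?thesis unfolding weak_functional_def 1 3 sum_distrib_left[symmetric] by (simp add: right_diff_distrib)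
qed

lemma weak_functional_add_left:
  assumes S: "2 simplex S" and u: "u \<in> local_weak k S" and v: "v \<in> local_weak k S" and q: "q \<in> Pvec n S"
  shows "weak_functional (u + v) S q = weak_functional u S q + weak_functional v S q"
proof -
  have 1: "(LINT x|lebesgue_on S. fst (u + v) S x * divergence q x)
    = (LINT x|lebesgue_on S. fst u S x * divergence q x) + (LINT x|lebesgue_on S. fst v S x * divergence q x)"
    using Bochner_Integration.integral_add[OF integrable_div_term[OF S u q] integrable_div_term[OF S v q]]
    by (simp add: distrib_right)
  have 2: "edge_integral e (\<lambda>x. snd (u + v) e x * (q x \<bullet> outward_normal S e))
    = edge_integral e (\<lambda>x. snd u e x * (q x \<bullet> outward_normal S e)) + edge_integral e (\<lambda>x. snd v e x * (q x \<bullet> outward_normal S e))"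
    if ed: "e edge_of S" for e
  proof -
    obtain P Q where e: "e = closed_segment P Q" using edge_of_simplex2[OF S ed] by blast
    show ?thesis
      using edge_integral_add[OF edge_term_continuous[OF ed u q, unfolded e] edge_term_continuous[OF ed v q, unfolded e]]
      by (simp add: e distrib_right)
  qed
  have 3: "(\<Sum>e | e edge_of S. edge_integral e (\<lambda>x. snd (u + v) e x * (q x \<bullet> outward_normal S e)))
    = (\<Sum>e | e edge_of S. edge_integral e (\<lambda>x. snd u e x * (q x \<bullet> outward_normal S e)) + edge_integral e (\<lambda>x. snd v e x * (q x \<bullet> outward_normal S e)))"
    by (rule sum.cong) (use 2 in auto)
  show ?thesis unfolding weak_functional_def 1 3 sum.distrib by simp
qed

lemma weak_functional_scale_left:
  assumes S: "2 simplex S"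
  shows "weak_functional (c *\<^sub>R v) S q = c * weak_functional v S q"
proof -
  have 2: "edge_integral e (\<lambda>x. snd (c *\<^sub>R v) e x * (q x \<bullet> outward_normal S e))
    = c * edge_integral e (\<lambda>x. snd v e x * (q x \<bullet> outward_normal S e))" if ed: "e edge_of S" for e
  proof -
    obtain P Q where e: "e = closed_segment P Q" using edge_of_simplex2[OF S ed] by blast
    show ?thesis unfolding e edge_integral_cmult[symmetric] by (simp add: mult.assoc)
  qed
  have 3: "(\<Sum>e | e edge_of S. edge_integral e (\<lambda>x. snd (c *\<^sub>R v) e x * (q x \<bullet> outward_normal S e)))
    = (\<Sum>e | e edge_of S. c * edge_integral e (\<lambda>x. snd v e x * (q x \<bullet> outward_normal S e)))"
    by (rule sum.cong) (use 2 in auto)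
  show ?thesis unfolding weak_functional_def 3 sum_distrib_left[symmetric] by (simp add: right_diff_distrib mult.assoc)
qed

lemma Pvec_L2_definite:
  assumes S: "2 simplex S" and q: "q \<in> Pvec n S" and 0: "(LINT x|lebesgue_on S. q x \<bullet> q x) = 0"
  shows "q = 0"
proof
  fix x
  show "q x = 0 x"
  proof (cases "x \<in> S")
    case True
    have "q x \<bullet> q x = 0"
      using Pvec_continuous[OF q]
      by (intro integral_0_convex_imp_0[OF compact_simplex2[OF S] convex_simplex2[OF S] interior_simplex2[OF S] _ _ 0 True])
        (auto intro!: continuous_intros)
    then show ?thesis by simp
  qed (use Pvec_outside[OF q] in simp)
qed

lemma integrable_Pvec_inner:
  assumes "2 simplex S" "q \<in> Pvec n S" "r \<in> Pvec n S"
  shows "integrable (lebesgue_on S) (\<lambda>x. q x \<bullet> r x)"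
  using assms Pvec_continuous by (intro integrable_compact compact_simplex2 continuous_intros) auto

lemma Pvec_semidefinite_form:
  assumes S: "2 simplex S"
  shows "semidefinite_form (Pvec n S) (\<lambda>q r. LINT x|lebesgue_on S. q x \<bullet> r x)"
proof
  show "subspace (Pvec n S)" by (rule subspace_Pvec)
  show "(LINT x|lebesgue_on S. (q + r) x \<bullet> w x) = (LINT x|lebesgue_on S. q x \<bullet> w x) + (LINT x|lebesgue_on S. r x \<bullet> w x)"
    if "q \<in> Pvec n S" "r \<in> Pvec n S" "w \<in> Pvec n S" for q r w
    using that integrable_Pvec_inner[OF S] by (simp add: inner_add_left)
qed (auto simp: inner_commute intro!: integral_nonneg_AE)

text \<open>Riesz representation for the definite L2 product on vector polynomials; it gives the
  definite description \<open>weak_gradient\<close> its meaning.\<close>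

lemma weak_gradient_ex1:
  assumes S: "2 simplex S" and v: "v \<in> local_weak k S"
  shows "\<exists>!r. r \<in> Pvec n S \<and> (\<forall>q\<in>Pvec n S. (LINT x|lebesgue_on S. r x \<bullet> q x) = weak_functional v S q)"
proof -
  interpret semidefinite_form "Pvec n S" "\<lambda>q r. LINT x|lebesgue_on S. q x \<bullet> r x"
    by (rule Pvec_semidefinite_form[OF S])
  obtain B where "finite B" "Pvec n S \<subseteq> span B" using Pvec_finite_span by blast
  then show ?thesis
    by (rule riesz_unique)
      (use weak_functional_add_right[OF S v] weak_functional_scale_right[OF S v] Pvec_L2_definite[OF S] in auto)
qed

lemma weak_gradient_alt:
  "weak_gradient k v S = (THE r. r \<in> Pvec (k + 1) S \<and>
    (\<forall>q\<in>Pvec (k + 1) S. (LINT x|lebesgue_on S. r x \<bullet> q x) = weak_functional v S q))"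
  by (simp add: weak_gradient_def weak_functional_def)

lemma
  assumes "2 simplex S" "v \<in> local_weak k S"
  shows weak_gradient_in_Pvec: "weak_gradient k v S \<in> Pvec (k + 1) S"
    and weak_gradient_inner: "q \<in> Pvec (k + 1) S \<Longrightarrow>
      (LINT x|lebesgue_on S. weak_gradient k v S x \<bullet> q x) = weak_functional v S q"
  using theI'[OF weak_gradient_ex1[OF assms, of "k + 1"]] unfolding weak_gradient_alt by blast+

lemma weak_gradient_eqI:
  assumes "2 simplex S" "v \<in> local_weak k S" "r \<in> Pvec (k + 1) S"
    and "\<And>q. q \<in> Pvec (k + 1) S \<Longrightarrow> (LINT x|lebesgue_on S. r x \<bullet> q x) = weak_functional v S q"
  shows "weak_gradient k v S = r"
  unfolding weak_gradient_alt using weak_gradient_ex1[OF assms(1,2)] assms(3,4)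
  by (intro the1_equality) auto

lemma weak_gradient_add:
  assumes S: "2 simplex S" and u: "u \<in> local_weak k S" and v: "v \<in> local_weak k S"
  shows "weak_gradient k (u + v) S = weak_gradient k u S + weak_gradient k v S"
proof (rule weak_gradient_eqI[OF S])
  note mem = weak_gradient_in_Pvec[OF S u] weak_gradient_in_Pvec[OF S v]
  show "u + v \<in> local_weak k S" using u v subspace_local_weak subspace_add by blast
  show "weak_gradient k u S + weak_gradient k v S \<in> Pvec (k + 1) S"
    using mem subspace_Pvec subspace_add by blast
  fix q assume q: "q \<in> Pvec (k + 1) S"
  show "(LINT x|lebesgue_on S. (weak_gradient k u S + weak_gradient k v S) x \<bullet> q x) = weak_functional (u + v) S q"
    using weak_gradient_inner[OF S u q] weak_gradient_inner[OF S v q] weak_functional_add_left[OF S u v q]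
      integrable_Pvec_inner[OF S mem(1) q] integrable_Pvec_inner[OF S mem(2) q]
    by (simp add: inner_add_left)
qed

lemma weak_gradient_scale:
  assumes S: "2 simplex S" and v: "v \<in> local_weak k S"
  shows "weak_gradient k (c *\<^sub>R v) S = c *\<^sub>R weak_gradient k v S"
proof (rule weak_gradient_eqI[OF S])
  show "c *\<^sub>R v \<in> local_weak k S" using v subspace_local_weak subspace_scale by blast
  show "c *\<^sub>R weak_gradient k v S \<in> Pvec (k + 1) S"
    using weak_gradient_in_Pvec[OF S v] subspace_Pvec subspace_scale by blast
  fix q assume q: "q \<in> Pvec (k + 1) S"
  show "(LINT x|lebesgue_on S. (c *\<^sub>R weak_gradient k v S) x \<bullet> q x) = weak_functional (c *\<^sub>R v) S q"
    using weak_gradient_inner[OF S v q] weak_functional_scale_left[OF S] by simp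
qed

lemma weak_gradient_zero_imp_constant:
  assumes S: "2 simplex S" and k: "k \<ge> 1" and v: "v \<in> local_weak k S" and 0: "weak_gradient k v S = 0"
  shows "\<exists>c. (\<forall>x\<in>S. fst v S x = c) \<and> (\<forall>e. e edge_of S \<longrightarrow> (\<forall>x\<in>e. snd v e x = c))"
proof -
  obtain A B C where tri: "triangle A B C" and T: "S = triangle.T A B C"
    using simplex_triangle[OF S] by blast
  have "weak_functional v S q = 0" if "q \<in> Pvec (k + 1) S" for q
    using weak_gradient_inner[OF S v that] 0 by simp
  then show ?thesis
    using triangle.weak_functional_zero_imp_constant[OF tri k, of v] v unfolding T local_weak_def by auto
qed

section \<open>Square integrable data and the projection onto edge polynomials\<close>

lemma integrable_mult_L2:
  fixes f g :: "'a::euclidean_space \<Rightarrow> real"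
  assumes "L2_on S f" "L2_on S g"
  shows "integrable (lebesgue_on S) (\<lambda>x. f x * g x)"
proof (rule Bochner_Integration.integrable_bound)
  show "integrable (lebesgue_on S) (\<lambda>x. (f x)\<^sup>2 + (g x)\<^sup>2)"
    using assms by (auto simp: L2_on_def)
  show "(\<lambda>x. f x * g x) \<in> borel_measurable (lebesgue_on S)"
    using assms by (auto simp: L2_on_def)
  have "\<bar>a * b\<bar> \<le> a\<^sup>2 + b\<^sup>2" for a b :: real
  proof -
    have "0 \<le> (\<bar>a\<bar> - \<bar>b\<bar>)\<^sup>2" by simp
    then have "2 * \<bar>a * b\<bar> \<le> a\<^sup>2 + b\<^sup>2" by (simp add: power2_diff abs_mult)
    then show ?thesis using abs_ge_zero[of "a * b"] by linarith
  qed
  then show "AE x in lebesgue_on S. norm (f x * g x) \<le> norm ((f x)\<^sup>2 + (g x)\<^sup>2)"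
    by (auto intro!: AE_I2)
qed

lemma L2_on_continuous:
  fixes f :: "'a::euclidean_space \<Rightarrow> real"
  assumes "compact S" "continuous_on S f"
  shows "L2_on S f"
  using assms integrable_compact[OF assms(1), of "\<lambda>x. (f x)\<^sup>2"]
  by (auto simp: L2_on_def continuous_imp_measurable_on_sets_lebesgue compact_imp_sets_lebesgue intro!: continuous_intros)

text \<open>Riesz representation on the edge. Square integrability of \<open>g\<close> makes all
  moments against polynomials finite; membership in the space is what puts the lift of the boundary
  data into \<open>Vh\<close>.\<close>

lemma Qb_in_Pk:
  assumes e: "e = closed_segment P Q" "P \<noteq> Q" and g: "L2_on {0..1} (\<lambda>t. g (linepath P Q t))"
  shows "Qb k e g \<in> Pk (k + 1) e"
proof -
  have cl: "continuous_on {0..1} (\<lambda>t. p (linepath P Q t))" if "p \<in> Pk (k + 1) e" for p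
    using continuous_on_compose2[OF Pk_continuous[OF that] continuous_on_linepath[of "{0..1}" P Q]]
    by (simp add: e linepath_image_01)
  have int: "integrable (lebesgue_on {0..1}) (\<lambda>t. p (linepath P Q t) * w (linepath P Q t))"
    if "p \<in> Pk (k + 1) e" "w \<in> Pk (k + 1) e" for p w
    using cl that by (intro integrable_compact continuous_intros) auto
  have intg: "integrable (lebesgue_on {0..1}) (\<lambda>t. g (linepath P Q t) * w (linepath P Q t))"
    if "w \<in> Pk (k + 1) e" for w
    using integrable_mult_L2[OF g L2_on_continuous[OF _ cl[OF that]]] by simp
  have definite: "p = 0" if p: "p \<in> Pk (k + 1) e" and 0: "edge_integral e (\<lambda>x. p x * p x) = 0" for p
  proof
    fix x
    show "p x = 0 x"
    proof (cases "x \<in> e")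
      case True
      then obtain t where t: "t \<in> {0..1}" "x = linepath P Q t"
        unfolding e by (auto simp: closed_segment_def linepath_def)
      have I: "(LINT t|lebesgue_on {0..1}. p (linepath P Q t) * p (linepath P Q t)) = 0"
        using 0 e by (simp add: edge_integral_segment)
      then have "p (linepath P Q t) * p (linepath P Q t) = 0"
        using cl[OF p] by (intro integral_0_convex_imp_0[OF _ _ _ _ _ I t(1)]) (auto intro!: continuous_intros)
      then show ?thesis using t by simp
    qed (use p in \<open>auto simp: Pk_eq restr_def\<close>)
  qed
  interpret semidefinite_form "Pk (k + 1) e" "\<lambda>p w. edge_integral e (\<lambda>x. p x * w x)"
  proof
    show "subspace (Pk (k + 1) e)" by (rule subspace_Pk)
    show "edge_integral e (\<lambda>x. (p + r) x * w x) = edge_integral e (\<lambda>x. p x * w x) + edge_integral e (\<lambda>x. r x * w x)"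
      if "p \<in> Pk (k + 1) e" "r \<in> Pk (k + 1) e" "w \<in> Pk (k + 1) e" for p r w
      using int that by (simp add: e edge_integral_segment distrib_right distrib_left)
    show "edge_integral e (\<lambda>x. (c *\<^sub>R p) x * w x) = c * edge_integral e (\<lambda>x. p x * w x)" for c p w
      by (simp add: e edge_integral_segment mult.assoc)
    show "0 \<le> edge_integral e (\<lambda>x. p x * p x)" for p
      by (simp add: e edge_integral_segment integral_nonneg_AE)
  qed (simp add: mult.commute)
  obtain B where B: "finite B" "Pk (k + 1) e \<subseteq> span B" using Pk_finite_span by blast
  have "\<exists>!p. p \<in> Pk (k + 1) e \<and> (\<forall>w\<in>Pk (k + 1) e. edge_integral e (\<lambda>x. p x * w x) = edge_integral e (\<lambda>x. g x * w x))"
  proof (rule riesz_unique[OF B])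
    show "edge_integral e (\<lambda>x. g x * (u + v) x) = edge_integral e (\<lambda>x. g x * u x) + edge_integral e (\<lambda>x. g x * v x)"
      if "u \<in> Pk (k + 1) e" "v \<in> Pk (k + 1) e" for u v
      using intg that by (simp add: e edge_integral_segment distrib_left)
    show "edge_integral e (\<lambda>x. g x * (r *\<^sub>R u) x) = r * edge_integral e (\<lambda>x. g x * u x)" for r u
      by (simp add: e edge_integral_segment mult.left_commute)
  qed (use definite in auto)
  from theI'[OF this] show ?thesis unfolding Qb_def by blast
qed

section \<open>Weak functions with zero weak gradient on a mesh\<close>

text \<open>The elements with constant \<open>c T0\<close> and the remaining ones form two closed
  sets covering \<Omega> - V. They cannot meet off V, since two elements with a common point there
  share an edge or coincide. Connectedness leaves one value, and a boundary edge fixes it.\<close>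

lemma mesh_constants_vanish:
  fixes c :: "R2 set \<Rightarrow> real" and vb :: "R2 set \<Rightarrow> R2 \<Rightarrow> real"
  assumes \<Omega>: "polygonal_domain \<Omega>" and mesh: "triangular_mesh \<Omega> \<T>"
    and c: "\<And>T e x. \<lbrakk>T \<in> \<T>; e edge_of T; x \<in> e\<rbrakk> \<Longrightarrow> vb e x = c T"
    and bd: "\<And>e x. \<lbrakk>e \<in> boundary_edges \<Omega> \<T>; x \<in> e\<rbrakk> \<Longrightarrow> vb e x = 0"
    and T0: "T0 \<in> \<T>"
  shows "c T0 = 0"
proof -
  have fin: "finite \<T>" and simp2: "\<And>T. T \<in> \<T> \<Longrightarrow> 2 simplex T"
    and cap: "\<And>T T'. \<lbrakk>T \<in> \<T>; T' \<in> \<T>\<rbrakk> \<Longrightarrow> (T \<inter> T') face_of T"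
    and cover: "\<Union>\<T> = closure \<Omega>" and front: "\<Union>(boundary_edges \<Omega> \<T>) = frontier \<Omega>"
    using mesh by (auto simp: triangular_mesh_def triangulation_def)
  have op: "open \<Omega>" "connected \<Omega>" "bounded \<Omega>" "\<Omega> \<noteq> {}"
    using \<Omega> by (auto simp: polygonal_domain_def)
  define V where "V = {x. \<exists>T\<in>\<T>. {x} face_of T}"
  have "finite {x. {x} face_of T}" if "T \<in> \<T>" for T
  proof -
    have "finite {F. F face_of T}"
      by (rule finite_polytope_faces[OF simplex_imp_polytope[OF simp2[OF that]]])
    then have "finite ((\<lambda>x. {x}) -` {F. F face_of T})"
      by (rule finite_vimageI) (auto simp: inj_on_def)
    then show ?thesis by (simp add: vimage_def)
  qed
  then have "finite (\<Union>T\<in>\<T>. {x. {x} face_of T})" using fin by blast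
  moreover have "V = (\<Union>T\<in>\<T>. {x. {x} face_of T})" by (auto simp: V_def)
  ultimately have finV: "finite V" by simp
  \<comment> \<open>In dimension at least two, a countable set does not disconnect a connected open
    set.\<close>
  have conn: "connected (\<Omega> - V)"
    by (rule connected_open_diff_countable) (use op finV in \<open>auto simp: countable_finite\<close>)
  have disj: "c T = c T'" if T: "T \<in> \<T>" "T' \<in> \<T>" and x: "x \<in> T" "x \<in> T'" "x \<notin> V" for T T' x
  proof -
    define F where "F = T \<inter> T'"
    have F: "F face_of T" "F face_of T'"
      using cap[OF T] cap[OF T(2) T(1)] by (simp_all add: F_def Int_commute)
    have "aff_dim F \<le> 2"
      using aff_dim_subset[OF face_of_imp_subset[OF F(1)]] aff_dim_simplex[OF simp2[OF T(1)]] by simp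
    moreover have "F \<noteq> {}" using x by (auto simp: F_def)
    then have "aff_dim F \<ge> 0" using aff_dim_negative_iff[of F] by linarith
    \<comment> \<open>A common vertex would put \<open>x\<close> into V; a common edge compares the
      two constants through \<open>vb\<close>; a face of dimension 2 is the whole triangle, so T =
      T'.\<close>
    ultimately consider "aff_dim F = 0" | "aff_dim F = 1" | "aff_dim F = 2" by linarith
    then show ?thesis
    proof cases
      case 1
      then obtain y where "F = {y}" by (auto simp: aff_dim_eq_0)
      moreover have "x \<in> F" using x by (simp add: F_def)
      ultimately have "F = {x}" by simp
      then show ?thesis using F T x by (auto simp: V_def)
    next
      case 2
      then have "F edge_of T" "F edge_of T'" using F by (auto simp: edge_of_def)
      then show ?thesis using c[OF T(1), of F x] c[OF T(2), of F x] x by (simp add: F_def)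
    next
      case 3
      have "F = T"
        using face_of_aff_dim_lt[OF convex_simplex2[OF simp2[OF T(1)]] F(1)] 3 aff_dim_simplex[OF simp2[OF T(1)]] by force
      moreover have "F = T'"
        using face_of_aff_dim_lt[OF convex_simplex2[OF simp2[OF T(2)]] F(2)] 3 aff_dim_simplex[OF simp2[OF T(2)]] by force
      ultimately show ?thesis by simp
    qed
  qed
  \<comment> \<open>An element is only known to lie in the closure of \<Omega>. Its interior is
    open, hence meets \<Omega> itself, in an infinite set that finitely many vertices cannot
    exhaust.\<close>
  have meets: "T \<inter> (\<Omega> - V) \<noteq> {}" if "T \<in> \<T>" for T
  proof -
    have "interior T \<inter> closure \<Omega> = interior T"
      using cover that interior_subset by blast
    then have "interior T \<inter> \<Omega> \<noteq> {}"
      using open_Int_closure_eq_empty[OF open_interior, of T \<Omega>] interior_simplex2[OF simp2[OF that]] by simp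
    moreover have "open (interior T \<inter> \<Omega>)" using op by auto
    ultimately have "infinite (interior T \<inter> \<Omega>)" using finite_imp_not_open by blast
    then have "interior T \<inter> \<Omega> - V \<noteq> {}" using finV by (metis finite.emptyI finite_Diff2)
    then show ?thesis using interior_subset by blast
  qed
  define U where "U = \<Union>{T \<in> \<T>. c T = c T0}"
  define U' where "U' = \<Union>{T \<in> \<T>. c T \<noteq> c T0}"
  have cl: "closed T" if "T \<in> \<T>" for T
    using compact_simplex2[OF simp2[OF that]] compact_imp_closed by blast
  have closed: "closed U" "closed U'" unfolding U_def U'_def using fin cl by auto
  have "\<Omega> \<subseteq> \<Union>\<T>" using cover closure_subset by simp
  then have sub: "\<Omega> - V \<subseteq> U \<union> U'" unfolding U_def U'_def by blast
  have "x \<notin> U'" if xU: "x \<in> U" "x \<notin> V" for x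
  proof
    assume "x \<in> U'"
    then obtain T' where T': "T' \<in> \<T>" "c T' \<noteq> c T0" "x \<in> T'" unfolding U'_def by blast
    obtain T where "T \<in> \<T>" "c T = c T0" "x \<in> T" using xU unfolding U_def by blast
    then show False using disj[of T T' x] T' xU by simp
  qed
  then have empty: "(\<Omega> - V) \<inter> U \<inter> U' = {}" by blast
  have "U \<inter> (\<Omega> - V) \<noteq> {}" using meets[OF T0] T0 unfolding U_def by blast
  then have "U' \<inter> (\<Omega> - V) = {}"
    using connected_closedD[OF conn, of U U'] closed sub empty by (auto simp: Int_ac)
  then have const: "c T = c T0" if "T \<in> \<T>" for T
    using meets[OF that] that by (auto simp: U'_def)
  \<comment> \<open>A bounded nonempty set has a frontier, and the mesh resolves it; so a boundary
    edge exists.\<close>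
  have "\<Omega> \<noteq> UNIV" using op by auto
  then have "frontier \<Omega> \<noteq> {}" using op frontier_not_empty by blast
  then obtain x e where e: "x \<in> e" "e \<in> boundary_edges \<Omega> \<T>" using front by blast
  then obtain T where T: "T \<in> \<T>" "e edge_of T" by (auto simp: boundary_edges_def edges_def)
  show ?thesis using c[OF T e(1)] bd[OF e(2,1)] const[OF T(1)] by simp
qed

section \<open>Null frontier and bounded coefficients\<close>

lemma negligible_segment:
  fixes p q :: R2
  shows "negligible (closed_segment p q)"
proof -
  have "closed_segment p q \<subseteq> affine hull {p, q}"
    by (simp add: segment_convex_hull convex_hull_subset_affine_hull)
  moreover have "interior (affine hull {p, q}) = {}"
    by (rule empty_interior_affine_hull) (auto simp: card_insert_if)
  ultimately have "interior (closed_segment p q) = {}" using interior_mono by blast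
  then have "frontier (closed_segment p q) = closed_segment p q"
    by (simp add: frontier_def)
  then show ?thesis using negligible_convex_frontier[of "closed_segment p q"] by simp
qed

lemma negligible_frontier_polygonal:
  assumes "polygonal_domain \<Omega>"
  shows "negligible (frontier \<Omega>)"
proof -
  obtain S where "finite S" "frontier \<Omega> = (\<Union>(p, q)\<in>S. closed_segment p q)"
    using assms by (auto simp: polygonal_domain_def)
  then show ?thesis using negligible_segment by (auto intro!: negligible_Union)
qed

text \<open>Unit vectors bound the diagonal, and (1, 1) then bounds the off-diagonal entry by
  symmetry. Entrywise bounds are what the integrability of the energy rests on.\<close>

lemma matrix_entry_bound:
  fixes M :: "real^2^2"
  assumes sym: "transpose M = M" and lam: "lam1 > 0"
    and bnd: "\<And>\<xi>. lam1 * (\<xi> \<bullet> \<xi>) \<le> \<xi> \<bullet> (M *v \<xi>) \<and> \<xi> \<bullet> (M *v \<xi>) \<le> lam2 * (\<xi> \<bullet> \<xi>)"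
  shows "\<bar>M $ i $ j\<bar> \<le> lam2"
proof -
  have quad: "\<xi> \<bullet> (M *v \<xi>) = M $ 1 $ 1 * (\<xi> $ 1)\<^sup>2 + (M $ 1 $ 2 + M $ 2 $ 1) * \<xi> $ 1 * \<xi> $ 2 + M $ 2 $ 2 * (\<xi> $ 2)\<^sup>2" for \<xi>
    by (simp add: inner_vec_def matrix_vector_mult_def UNIV_2 power2_eq_square algebra_simps)
  have ip: "\<xi> \<bullet> \<xi> = (\<xi> $ 1)\<^sup>2 + (\<xi> $ 2)\<^sup>2" for \<xi> :: R2
    by (simp add: inner_vec_def UNIV_2 power2_eq_square)
  have off: "M $ 2 $ 1 = M $ 1 $ 2" using arg_cong[OF sym, of "\<lambda>A. A $ 1 $ 2"] by (simp add: transpose_def)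
  have 1: "0 < M $ 1 $ 1" "M $ 1 $ 1 \<le> lam2"
    using bnd[of "pt 1 0"] lam unfolding quad ip by auto
  have 2: "0 < M $ 2 $ 2" "M $ 2 $ 2 \<le> lam2"
    using bnd[of "pt 0 1"] lam unfolding quad ip by auto
  have 3: "0 < M $ 1 $ 1 + 2 * M $ 1 $ 2 + M $ 2 $ 2" "M $ 1 $ 1 + 2 * M $ 1 $ 2 + M $ 2 $ 2 \<le> 2 * lam2"
    using bnd[of "pt 1 1"] lam unfolding quad ip by (auto simp: off)
  show ?thesis
    using exhaust_2[of i] exhaust_2[of j] off 1 2 3 by (auto simp: abs_le_iff)
qed

lemma integrable_coefficient:
  fixes b :: "R2 \<Rightarrow> real^2^2"
  assumes meas: "\<And>i j. (\<lambda>x. b x $ i $ j) \<in> borel_measurable lebesgue"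
    and bnd: "\<And>x i j. \<bar>b x $ i $ j\<bar> \<le> M"
    and S: "compact S" and r: "continuous_on S r" and q: "continuous_on S q"
  shows "integrable (lebesgue_on S) (\<lambda>x. (b x *v r x) \<bullet> q x)"
proof -
  have "integrable (lebesgue_on S) (\<lambda>x. b x $ i $ j * (r x $ j * q x $ i))" for i j
  proof (rule Bochner_Integration.integrable_bound)
    have c: "continuous_on S (\<lambda>x. r x $ j * q x $ i)" by (intro continuous_intros r q)
    then show "integrable (lebesgue_on S) (\<lambda>x. M * (r x $ j * q x $ i))"
      using integrable_compact[OF S continuous_on_mult[OF continuous_on_const[of S M] c]] by simp
    have "(\<lambda>x. r x $ j * q x $ i) \<in> borel_measurable (lebesgue_on S)"
      using c S compact_imp_sets_lebesgue continuous_imp_measurable_on_sets_lebesgue by blast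
    then show "(\<lambda>x. b x $ i $ j * (r x $ j * q x $ i)) \<in> borel_measurable (lebesgue_on S)"
      using measurable_restrict_space1[OF meas] by (rule borel_measurable_times[rotated])
    have "norm (b x $ i $ j * z) \<le> norm (M * z)" for x z
      unfolding norm_mult using bnd[of x i j] by (intro mult_right_mono) auto
    then show "AE x in lebesgue_on S. norm (b x $ i $ j * (r x $ j * q x $ i)) \<le> norm (M * (r x $ j * q x $ i))"
      by (intro AE_I2)
  qed
  then have "integrable (lebesgue_on S) (\<lambda>x. \<Sum>i\<in>UNIV. \<Sum>j\<in>UNIV. b x $ i $ j * (r x $ j * q x $ i))"
    by auto
  moreover have "(b x *v r x) \<bullet> q x = (\<Sum>i\<in>UNIV. \<Sum>j\<in>UNIV. b x $ i $ j * (r x $ j * q x $ i))" for x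
    by (simp add: inner_vec_def matrix_vector_mult_def sum_distrib_right mult.assoc)
  ultimately show ?thesis by simp
qed

section \<open>\<open>Vh\<close> as a finitely spanned space\<close>

lemma subspace_Vh: "subspace (Vh k \<T>)"
  using subspace_Pk unfolding Vh_def subspace_def
  by (auto simp: split_def zero_fun_def plus_fun_def scaleR_fun_def)

lemma subspace_Vh0: "subspace (Vh0 k \<Omega> \<T>)"
  using subspace_Vh[of k \<T>] unfolding Vh0_def subspace_def by auto

lemma Vh_local: "\<lbrakk>v \<in> Vh k \<T>; T \<in> \<T>\<rbrakk> \<Longrightarrow> v \<in> local_weak k T"
  unfolding Vh_def local_weak_def edges_def by auto

text \<open>A weak function is the sum of its components, each embedded as a family supported at a
  single index. The zero convention outside the mesh makes this an equality of families.\<close>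

lemma Vh_finite_span:
  assumes fin: "finite \<T>" "finite (edges \<T>)"
  shows "\<exists>B. finite B \<and> Vh k \<T> \<subseteq> span B"
proof -
  define E :: "R2 set \<Rightarrow> (R2 \<Rightarrow> real) \<Rightarrow> R2 set \<Rightarrow> R2 \<Rightarrow> real"
    where "E T p = (\<lambda>S. if S = T then p else 0)" for T p
  define I :: "R2 set \<Rightarrow> (R2 \<Rightarrow> real) \<Rightarrow> weak_fun" where "I T p = (E T p, 0)" for T p
  define I' :: "R2 set \<Rightarrow> (R2 \<Rightarrow> real) \<Rightarrow> weak_fun" where "I' e p = (0, E e p)" for e p
  have E: "E T (p + q) = E T p + E T q" "E T (c *\<^sub>R p) = c *\<^sub>R E T p" for T p q c
    by (auto simp: E_def fun_eq_iff)
  have lin: "linear (I T)" "linear (I' T)" for T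
    by (auto intro!: linearI simp: I_def I'_def E)
  obtain B where B: "\<And>m S. finite (B m S)" "\<And>m S. Pk m S \<subseteq> span (B m S :: (R2 \<Rightarrow> real) set)"
    using Pk_finite_span by metis
  define C where "C = (\<Union>T\<in>\<T>. I T ` B k T) \<union> (\<Union>e\<in>edges \<T>. I' e ` B (k + 1) e)"
  have "v \<in> span C" if v: "v \<in> Vh k \<T>" for v
  proof -
    have "(\<Sum>T\<in>\<T>. E T (fst v T)) = fst v"
    proof
      fix S
      have "(\<Sum>T\<in>\<T>. E T (fst v T)) S = (\<Sum>T\<in>\<T>. if T = S then fst v S else 0)"
        by (subst sum_fun_apply, rule sum.cong) (auto simp: E_def)
      then show "(\<Sum>T\<in>\<T>. E T (fst v T)) S = fst v S"
        using v fin by (auto simp: Vh_def zero_fun_def)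
    qed
    moreover have "(\<Sum>e\<in>edges \<T>. E e (snd v e)) = snd v"
    proof
      fix S
      have "(\<Sum>e\<in>edges \<T>. E e (snd v e)) S = (\<Sum>e\<in>edges \<T>. if e = S then snd v S else 0)"
        by (subst sum_fun_apply, rule sum.cong) (auto simp: E_def)
      then show "(\<Sum>e\<in>edges \<T>. E e (snd v e)) S = snd v S"
        using v fin by (auto simp: Vh_def zero_fun_def)
    qed
    moreover have "fst (\<Sum>T\<in>\<T>. I T (fst v T)) = (\<Sum>T\<in>\<T>. E T (fst v T))" "snd (\<Sum>T\<in>\<T>. I T (fst v T)) = 0"
      "fst (\<Sum>e\<in>edges \<T>. I' e (snd v e)) = 0" "snd (\<Sum>e\<in>edges \<T>. I' e (snd v e)) = (\<Sum>e\<in>edges \<T>. E e (snd v e))"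
      by (simp_all add: fst_sum snd_sum I_def I'_def)
    ultimately have "v = (\<Sum>T\<in>\<T>. I T (fst v T)) + (\<Sum>e\<in>edges \<T>. I' e (snd v e))"
      by (intro prod_eqI) simp_all
    moreover have "I T (fst v T) \<in> span C" if "T \<in> \<T>" for T
    proof -
      have "fst v T \<in> span (B k T)" using v that B(2)[of k T] by (auto simp: Vh_def)
      then have "I T (fst v T) \<in> span (I T ` B k T)" using linear_span_image[OF lin(1)[of T]] by blast
      moreover have "I T ` B k T \<subseteq> C" using that by (auto simp: C_def)
      ultimately show ?thesis using span_mono by blast
    qed
    moreover have "I' e (snd v e) \<in> span C" if "e \<in> edges \<T>" for e
    proof -
      have "snd v e \<in> span (B (k + 1) e)" using v that B(2)[of "k + 1" e] by (auto simp: Vh_def)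
      then have "I' e (snd v e) \<in> span (I' e ` B (k + 1) e)" using linear_span_image[OF lin(2)[of e]] by blast
      moreover have "I' e ` B (k + 1) e \<subseteq> C" using that by (auto simp: C_def)
      ultimately show ?thesis using span_mono by blast
    qed
    ultimately show ?thesis by (metis (no_types, lifting) span_add span_sum)
  qed
  moreover have "finite C" using fin B by (simp add: C_def)
  ultimately show ?thesis by blast
qed

section \<open>The discrete problem\<close>

locale wg_problem =
  fixes \<Omega> :: "R2 set" and \<T> :: "R2 set set" and a :: "R2 \<Rightarrow> real^2^2" and f g :: "R2 \<Rightarrow> real"
    and lam1 lam2 :: real and k :: nat
  assumes domain: "polygonal_domain \<Omega>" and mesh: "triangular_mesh \<Omega> \<T>" and k: "k \<ge> 1"
    and lam1: "lam1 > 0"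
    and a_meas: "a \<in> borel_measurable (lebesgue_on \<Omega>)"
    and a_sym: "\<And>x. x \<in> \<Omega> \<Longrightarrow> transpose (a x) = a x"
    and a_bound: "\<And>x \<xi>. x \<in> \<Omega> \<Longrightarrow> lam1 * (\<xi> \<bullet> \<xi>) \<le> \<xi> \<bullet> (a x *v \<xi>) \<and> \<xi> \<bullet> (a x *v \<xi>) \<le> lam2 * (\<xi> \<bullet> \<xi>)"
    and f_L2: "L2_on \<Omega> f" and g_L2: "L2_on_boundary \<Omega> g"
begin

text \<open>The coefficient is only controlled on \<open>\<Omega>\<close>, whereas the elements cover \<open>closure \<Omega>\<close>. Extending it
  to an elliptic coefficient on the whole plane does not change the integrals, because \<open>frontier \<Omega>\<close> is
  negligible.\<close>

definition ext :: "R2 \<Rightarrow> real^2^2"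
  where "ext x = (if x \<in> \<Omega> then a x else mat lam1)"

lemma open_domain: "open \<Omega>" and domain_nonempty: "\<Omega> \<noteq> {}"
  using domain by (auto simp: polygonal_domain_def)

lemma domain_lebesgue: "\<Omega> \<in> sets lebesgue"
  using open_domain by (simp add: borel_open)

lemma finite_mesh: "finite \<T>" and element_simplex: "T \<in> \<T> \<Longrightarrow> 2 simplex T"
  and element_subset: "T \<in> \<T> \<Longrightarrow> T \<subseteq> closure \<Omega>"
  using mesh by (auto simp: triangular_mesh_def triangulation_def)

lemma element_off_frontier: "\<lbrakk>T \<in> \<T>; x \<in> T - frontier \<Omega>\<rbrakk> \<Longrightarrow> x \<in> \<Omega>"
  using element_subset open_domain by (auto simp: frontier_def interior_open)

lemma element_lebesgue: "T \<in> \<T> \<Longrightarrow> T \<in> sets lebesgue"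
  using element_simplex compact_simplex2 compact_imp_sets_lebesgue by blast

lemma lam_le: "lam1 \<le> lam2"
proof -
  obtain x where "x \<in> \<Omega>" using domain_nonempty by blast
  from a_bound[OF this, of "axis 1 1"] show ?thesis by (simp add: inner_axis_axis)
qed

lemma ext_bound: "lam1 * (\<xi> \<bullet> \<xi>) \<le> \<xi> \<bullet> (ext x *v \<xi>) \<and> \<xi> \<bullet> (ext x *v \<xi>) \<le> lam2 * (\<xi> \<bullet> \<xi>)"
proof (cases "x \<in> \<Omega>")
  case True
  then show ?thesis using a_bound by (simp add: ext_def)
next
  case False
  have "mat lam1 *v \<xi> = lam1 *\<^sub>R \<xi>"
    by (simp add: vec_eq_iff matrix_vector_mult_def mat_def if_distrib[of "\<lambda>c. c * _"] cong: if_cong)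
  then show ?thesis using False lam_le by (simp add: ext_def mult_right_mono)
qed

lemma ext_sym: "transpose (ext x) = ext x"
  using a_sym by (simp add: ext_def transpose_mat)

lemma ext_entry: "\<bar>ext x $ i $ j\<bar> \<le> lam2"
  by (rule matrix_entry_bound[OF ext_sym lam1 ext_bound])

lemma ext_measurable: "(\<lambda>x. ext x $ i $ j) \<in> borel_measurable lebesgue"
proof -
  have "(\<lambda>A::real^2^2. A $ i $ j) \<in> borel_measurable borel"
    by (intro borel_measurable_continuous_onI continuous_intros)
  from measurable_compose[OF a_meas this]
  have "(\<lambda>x. if x \<in> \<Omega> then a x $ i $ j else 0) \<in> borel_measurable lebesgue"
    using borel_measurable_if[OF domain_lebesgue, of "\<lambda>x. a x $ i $ j"] by simp
  moreover have "(\<lambda>x. indicator (- \<Omega>) x * ((mat lam1 :: real^2^2) $ i $ j)) \<in> borel_measurable lebesgue"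
    using open_domain by (intro borel_measurable_times borel_measurable_indicator) (auto intro: borel_closed)
  ultimately have "(\<lambda>x. (if x \<in> \<Omega> then a x $ i $ j else 0) + indicator (- \<Omega>) x * ((mat lam1 :: real^2^2) $ i $ j)) \<in> borel_measurable lebesgue"
    by (rule borel_measurable_add)
  moreover have "(\<lambda>x. ext x $ i $ j) = (\<lambda>x. (if x \<in> \<Omega> then a x $ i $ j else 0) + indicator (- \<Omega>) x * ((mat lam1 :: real^2^2) $ i $ j))"
    by (auto simp: ext_def fun_eq_iff)
  ultimately show ?thesis by simp
qed

text \<open>Formed with \<open>ext\<close>, whose bounds hold at every point of an element;
  \<open>energy_eq\<close> returns to \<open>a\<close>.\<close>

definition energy :: "weak_fun \<Rightarrow> weak_fun \<Rightarrow> real"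
  where "energy u v = (\<Sum>T\<in>\<T>. LINT x|lebesgue_on T. (ext x *v weak_gradient k u T x) \<bullet> weak_gradient k v T x)"

lemma wg_in_Pvec: "\<lbrakk>v \<in> Vh k \<T>; T \<in> \<T>\<rbrakk> \<Longrightarrow> weak_gradient k v T \<in> Pvec (k + 1) T"
  using weak_gradient_in_Pvec element_simplex Vh_local by blast

lemma integrable_energy:
  assumes "u \<in> Vh k \<T>" "v \<in> Vh k \<T>" "T \<in> \<T>"
  shows "integrable (lebesgue_on T) (\<lambda>x. (ext x *v weak_gradient k u T x) \<bullet> weak_gradient k v T x)"
  using assms
  by (intro integrable_coefficient[OF ext_measurable ext_entry] compact_simplex2 element_simplex
    Pvec_continuous[OF wg_in_Pvec])

lemma energy_eq:
  assumes "u \<in> Vh k \<T>" "v \<in> Vh k \<T>"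
  shows "energy u v = (\<Sum>T\<in>\<T>. LINT x|lebesgue_on T. (a x *v weak_gradient k u T x) \<bullet> weak_gradient k v T x)"
  unfolding energy_def
proof (rule sum.cong[OF refl])
  fix T assume T: "T \<in> \<T>"
  show "(LINT x|lebesgue_on T. (ext x *v weak_gradient k u T x) \<bullet> weak_gradient k v T x)
    = (LINT x|lebesgue_on T. (a x *v weak_gradient k u T x) \<bullet> weak_gradient k v T x)"
    by (rule integral_lebesgue_on_spike[OF element_lebesgue[OF T] negligible_frontier_polygonal[OF domain]
          _ integrable_energy[OF assms T], symmetric])
      (use element_off_frontier[OF T] in \<open>auto simp: ext_def\<close>)
qed

lemma energy_pos:
  assumes u: "u \<in> Vh k \<T>"
  shows "lam1 * (\<Sum>T\<in>\<T>. LINT x|lebesgue_on T. weak_gradient k u T x \<bullet> weak_gradient k u T x) \<le> energy u u"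
  unfolding energy_def sum_distrib_left
proof (rule sum_mono)
  fix T assume T: "T \<in> \<T>"
  note P = wg_in_Pvec[OF u T]
  have "lam1 * (LINT x|lebesgue_on T. weak_gradient k u T x \<bullet> weak_gradient k u T x)
    = (LINT x|lebesgue_on T. lam1 * (weak_gradient k u T x \<bullet> weak_gradient k u T x))" by simp
  also have "\<dots> \<le> (LINT x|lebesgue_on T. (ext x *v weak_gradient k u T x) \<bullet> weak_gradient k u T x)"
    using integrable_Pvec_inner[OF element_simplex[OF T] P P] integrable_energy[OF u u T] ext_bound
    by (intro integral_mono) (auto simp: inner_commute)
  finally show "lam1 * (LINT x|lebesgue_on T. weak_gradient k u T x \<bullet> weak_gradient k u T x)
    \<le> (LINT x|lebesgue_on T. (ext x *v weak_gradient k u T x) \<bullet> weak_gradient k u T x)" .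
qed

lemma matrix_inner_sym:
  fixes M :: "real^2^2"
  assumes "transpose M = M"
  shows "(M *v x) \<bullet> y = (M *v y) \<bullet> x"
proof -
  have "M $ 2 $ 1 = M $ 1 $ 2" using arg_cong[OF assms, of "\<lambda>A. A $ 1 $ 2"] by (simp add: transpose_def)
  then show ?thesis by (simp add: inner_vec_def matrix_vector_mult_def UNIV_2 algebra_simps)
qed

text \<open>On all of \<open>Vh\<close>, since the lift has to be an admissible argument;
  definiteness is available on \<open>Vh0\<close> through \<open>energy_definite\<close>.\<close>

sublocale semidefinite_form "Vh k \<T>" energy
proof
  show "subspace (Vh k \<T>)" by (rule subspace_Vh)
  fix u v w assume u: "u \<in> Vh k \<T>" and v: "v \<in> Vh k \<T>" and w: "w \<in> Vh k \<T>"
  show "energy (u + v) w = energy u w + energy v w"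
    unfolding energy_def sum.distrib[symmetric]
  proof (rule sum.cong[OF refl])
    fix T assume T: "T \<in> \<T>"
    show "(LINT x|lebesgue_on T. (ext x *v weak_gradient k (u + v) T x) \<bullet> weak_gradient k w T x)
      = (LINT x|lebesgue_on T. (ext x *v weak_gradient k u T x) \<bullet> weak_gradient k w T x)
      + (LINT x|lebesgue_on T. (ext x *v weak_gradient k v T x) \<bullet> weak_gradient k w T x)"
      unfolding weak_gradient_add[OF element_simplex[OF T] Vh_local[OF u T] Vh_local[OF v T]]
      using integrable_energy[OF u w T] integrable_energy[OF v w T]
      by (simp add: matrix_vector_right_distrib inner_add_left)
  qed
next
  fix u w and r :: real assume u: "u \<in> Vh k \<T>" and w: "w \<in> Vh k \<T>"
  show "energy (r *\<^sub>R u) w = r * energy u w"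
    unfolding energy_def sum_distrib_left
  proof (rule sum.cong[OF refl])
    fix T assume T: "T \<in> \<T>"
    show "(LINT x|lebesgue_on T. (ext x *v weak_gradient k (r *\<^sub>R u) T x) \<bullet> weak_gradient k w T x)
      = r * (LINT x|lebesgue_on T. (ext x *v weak_gradient k u T x) \<bullet> weak_gradient k w T x)"
      unfolding weak_gradient_scale[OF element_simplex[OF T] Vh_local[OF u T]]
      by (simp add: matrix_vector_mult_scaleR)
  qed
  show "energy u w = energy w u"
    unfolding energy_def using matrix_inner_sym[OF ext_sym] by simp
next
  fix u assume u: "u \<in> Vh k \<T>"
  have "0 \<le> lam1 * (\<Sum>T\<in>\<T>. LINT x|lebesgue_on T. weak_gradient k u T x \<bullet> weak_gradient k u T x)"
    using lam1 by (intro mult_nonneg_nonneg sum_nonneg integral_nonneg_AE) auto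
  then show "0 \<le> energy u u" using energy_pos[OF u] by linarith
qed

lemma energy_definite:
  assumes u: "u \<in> Vh0 k \<Omega> \<T>" and 0: "energy u u = 0"
  shows "u = 0"
proof -
  have uV: "u \<in> Vh k \<T>" using u by (simp add: Vh0_def)
  have nn: "0 \<le> (LINT x|lebesgue_on T. weak_gradient k u T x \<bullet> weak_gradient k u T x)" for T
    by (rule integral_nonneg_AE) auto
  have "(\<Sum>T\<in>\<T>. LINT x|lebesgue_on T. weak_gradient k u T x \<bullet> weak_gradient k u T x) \<le> 0"
    using energy_pos[OF uV] 0 lam1 by (simp add: mult_le_0_iff)
  then have "(\<Sum>T\<in>\<T>. LINT x|lebesgue_on T. weak_gradient k u T x \<bullet> weak_gradient k u T x) = 0"
    using nn by (intro antisym sum_nonneg) auto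
  then have "(LINT x|lebesgue_on T. weak_gradient k u T x \<bullet> weak_gradient k u T x) = 0" if "T \<in> \<T>" for T
    using finite_mesh nn that by (simp add: sum_nonneg_eq_0_iff)
  then have "weak_gradient k u T = 0" if "T \<in> \<T>" for T
    using Pvec_L2_definite[OF element_simplex wg_in_Pvec[OF uV]] that by blast
  then have "\<forall>T\<in>\<T>. \<exists>c. (\<forall>x\<in>T. fst u T x = c) \<and> (\<forall>e. e edge_of T \<longrightarrow> (\<forall>x\<in>e. snd u e x = c))"
    using weak_gradient_zero_imp_constant[OF element_simplex k Vh_local[OF uV]] by blast
  then obtain c where c: "\<And>T x. \<lbrakk>T \<in> \<T>; x \<in> T\<rbrakk> \<Longrightarrow> fst u T x = c T"
    "\<And>T e x. \<lbrakk>T \<in> \<T>; e edge_of T; x \<in> e\<rbrakk> \<Longrightarrow> snd u e x = c T"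
    by metis
  have "c T = 0" if "T \<in> \<T>" for T
    using u by (intro mesh_constants_vanish[where vb = "snd u" and c = c, OF domain mesh c(2) _ that]) (auto simp: Vh0_def)
  then have z: "\<And>T x. \<lbrakk>T \<in> \<T>; x \<in> T\<rbrakk> \<Longrightarrow> fst u T x = 0" "\<And>e x. \<lbrakk>e \<in> edges \<T>; x \<in> e\<rbrakk> \<Longrightarrow> snd u e x = 0"
    using c by (auto simp: edges_def)
  \<comment> \<open>Zero extension turns vanishing on each element and edge into equality of the
    families.\<close>
  have out: "p x = 0" if "p \<in> Pk n S" "x \<notin> S" for p n S x
    using that by (auto simp: Pk_eq restr_def)
  have "fst u T x = 0" for T x
    using uV z(1)[of T x] out[of "fst u T" k T x] by (cases "T \<in> \<T>"; cases "x \<in> T") (auto simp: Vh_def)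
  moreover have "snd u e x = 0" for e x
    using uV z(2)[of e x] out[of "snd u e" "k + 1" e x] by (cases "e \<in> edges \<T>"; cases "x \<in> e") (auto simp: Vh_def)
  ultimately show ?thesis by (intro prod_eqI) (auto simp: fun_eq_iff)
qed

text \<open>Square integrability of \<open>f\<close> is known over \<Omega> only. Its zero extension
  \<open>h\<close> is square integrable over every element and differs from \<open>f\<close> there
  at most on the negligible frontier.\<close>

lemma integrable_load:
  assumes v: "v \<in> Vh k \<T>" and T: "T \<in> \<T>"
  shows "integrable (lebesgue_on T) (\<lambda>x. f x * fst v T x)"
proof -
  define h where "h = (\<lambda>x. if x \<in> \<Omega> then f x else 0)"
  have "h \<in> borel_measurable lebesgue"
    using f_L2 borel_measurable_if[OF domain_lebesgue, of f] by (simp add: h_def L2_on_def)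
  then have m: "h \<in> borel_measurable (lebesgue_on T)" by (rule measurable_restrict_space1)
  have "(\<lambda>x. (h x)\<^sup>2) = (\<lambda>x. if x \<in> \<Omega> then (f x)\<^sup>2 else 0)" by (auto simp: h_def)
  then have "integrable lebesgue (\<lambda>x. (h x)\<^sup>2)"
    using f_L2 Lebesgue_Measure.integrable_restrict_UNIV[OF domain_lebesgue, of "\<lambda>x. (f x)\<^sup>2"] by (simp add: L2_on_def)
  then have "integrable lebesgue (\<lambda>x. indicator T x *\<^sub>R (h x)\<^sup>2)"
    using integrable_mult_indicator[OF element_lebesgue[OF T]] by blast
  then have "integrable (lebesgue_on T) (\<lambda>x. (h x)\<^sup>2)"
    using element_lebesgue[OF T] by (subst integrable_restrict_space) auto
  with m have "L2_on T h" by (simp add: L2_on_def)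
  moreover have "L2_on T (fst v T)"
    using v T Pk_continuous by (intro L2_on_continuous compact_simplex2 element_simplex) (auto simp: Vh_def)
  ultimately have "integrable (lebesgue_on T) (\<lambda>x. h x * fst v T x)" by (rule integrable_mult_L2)
  then show ?thesis
    by (rule integrable_lebesgue_on_spike[OF element_lebesgue[OF T] negligible_frontier_polygonal[OF domain], rotated])
      (use element_off_frontier[OF T] in \<open>auto simp: h_def\<close>)
qed

definition load :: "weak_fun \<Rightarrow> real"
  where "load v = (\<Sum>T\<in>\<T>. LINT x|lebesgue_on T. f x * fst v T x)"

lemma load_add:
  assumes "u \<in> Vh k \<T>" "v \<in> Vh k \<T>"
  shows "load (u + v) = load u + load v"
  unfolding load_def sum.distrib[symmetric]
  by (rule sum.cong[OF refl]) (use integrable_load assms in \<open>simp add: distrib_left\<close>)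

lemma load_scale: "load (r *\<^sub>R u) = r * load u"
  unfolding load_def sum_distrib_left by (simp add: mult.left_commute)

text \<open>Components on different edges and elements are independent, so boundary data extended by
  zero stay in \<open>Vh\<close>, with no matching at vertices.\<close>

definition lift :: weak_fun
  where "lift = (\<lambda>_. 0, \<lambda>e. if e \<in> boundary_edges \<Omega> \<T> then Qb k e g else 0)"

lemma lift_in_Vh: "lift \<in> Vh k \<T>"
proof -
  have "Qb k e g \<in> Pk (k + 1) e" if "e \<in> boundary_edges \<Omega> \<T>" for e
  proof -
    obtain T where T: "T \<in> \<T>" "e edge_of T" and front: "e \<subseteq> frontier \<Omega>"
      using \<open>e \<in> _\<close> by (auto simp: boundary_edges_def edges_def)
    obtain P Q where "P \<noteq> Q" "e = closed_segment P Q"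
      by (rule edge_of_simplex2[OF element_simplex[OF T(1)] T(2)])
    then show ?thesis using g_L2 front by (intro Qb_in_Pk) (auto simp: L2_on_boundary_def)
  qed
  then show ?thesis
    using subspace_0[OF subspace_Pk]
    by (auto simp: Vh_def lift_def boundary_edges_def zero_fun_def)
qed

lemma boundary_condition_iff:
  assumes "u \<in> Vh k \<T>"
  shows "(\<forall>e\<in>boundary_edges \<Omega> \<T>. \<forall>x\<in>e. snd u e x = Qb k e g x) \<longleftrightarrow> u - lift \<in> Vh0 k \<Omega> \<T>"
  using subspace_diff[OF subspace_Vh assms lift_in_Vh] by (auto simp: Vh0_def lift_def)

lemma finite_edges: "finite (edges \<T>)"
proof -
  have "edges \<T> = (\<Union>T\<in>\<T>. {e. e edge_of T})" by (auto simp: edges_def)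
  then show ?thesis using finite_mesh finite_edges_simplex2 element_simplex by auto
qed

lemma solution_ex1:
  "\<exists>!u. u \<in> Vh k \<T> \<and> (\<forall>e\<in>boundary_edges \<Omega> \<T>. \<forall>x\<in>e. snd u e x = Qb k e g x) \<and>
    (\<forall>v\<in>Vh0 k \<Omega> \<T>. energy u v = load v)"
proof -
  have sub: "v \<in> Vh k \<T>" if "v \<in> Vh0 k \<Omega> \<T>" for v using that by (simp add: Vh0_def)
  \<comment> \<open>On this smaller space the energy is definite, as uniqueness requires; the
    ambient instance remains in use for the terms with \<open>lift\<close>.\<close>
  interpret H: semidefinite_form "Vh0 k \<Omega> \<T>" energy
    by standard (use sub subspace_Vh0 add scale sym nonneg in auto)
  obtain B where B: "finite B" "Vh k \<T> \<subseteq> span B"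
    using Vh_finite_span[OF finite_mesh finite_edges] by blast
  have "\<exists>!w. w \<in> Vh0 k \<Omega> \<T> \<and> (\<forall>v\<in>Vh0 k \<Omega> \<T>. energy w v = load v - energy lift v)"
  proof (rule H.riesz_unique[OF B(1)])
    show "Vh0 k \<Omega> \<T> \<subseteq> span B" using B sub by blast
    show "load (u + v) - energy lift (u + v) = (load u - energy lift u) + (load v - energy lift v)"
      if "u \<in> Vh0 k \<Omega> \<T>" "v \<in> Vh0 k \<Omega> \<T>" for u v
      using load_add add_right[OF sub[OF that(1)] sub[OF that(2)] lift_in_Vh] sub that by simp
    show "load (r *\<^sub>R u) - energy lift (r *\<^sub>R u) = r * (load u - energy lift u)"
      if "u \<in> Vh0 k \<Omega> \<T>" for r u
      using scale_right[OF sub[OF that] lift_in_Vh] by (simp add: load_scale right_diff_distrib)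
  qed (rule energy_definite)
  then obtain w where w: "w \<in> Vh0 k \<Omega> \<T>" "\<And>v. v \<in> Vh0 k \<Omega> \<T> \<Longrightarrow> energy w v = load v - energy lift v"
    and uniq: "\<And>w'. \<lbrakk>w' \<in> Vh0 k \<Omega> \<T>; \<forall>v\<in>Vh0 k \<Omega> \<T>. energy w' v = load v - energy lift v\<rbrakk> \<Longrightarrow> w' = w"
    by blast
  have split: "energy (w' + lift) v = energy w' v + energy lift v"
    if "w' \<in> Vh0 k \<Omega> \<T>" "v \<in> Vh0 k \<Omega> \<T>" for w' v
    using that sub by (intro add lift_in_Vh)
  show ?thesis
  proof (rule ex1I[of _ "w + lift"])
    have "w + lift \<in> Vh k \<T>"
      using sub[OF w(1)] lift_in_Vh subspace_add[OF subspace_Vh] by blast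
    then show "w + lift \<in> Vh k \<T> \<and> (\<forall>e\<in>boundary_edges \<Omega> \<T>. \<forall>x\<in>e. snd (w + lift) e x = Qb k e g x) \<and>
        (\<forall>v\<in>Vh0 k \<Omega> \<T>. energy (w + lift) v = load v)"
      using boundary_condition_iff[of "w + lift"] w split[OF w(1)] by simp
  next
    fix u assume u: "u \<in> Vh k \<T> \<and> (\<forall>e\<in>boundary_edges \<Omega> \<T>. \<forall>x\<in>e. snd u e x = Qb k e g x) \<and>
        (\<forall>v\<in>Vh0 k \<Omega> \<T>. energy u v = load v)"
    then have d: "u - lift \<in> Vh0 k \<Omega> \<T>" using boundary_condition_iff[of u] by blast
    have "energy (u - lift) v = load v - energy lift v" if "v \<in> Vh0 k \<Omega> \<T>" for v
      using split[OF d that] u that by simp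
    then have "u - lift = w" using uniq[OF d] by blast
    then show "u = w + lift" by (simp add: algebra_simps)
  qed
qed

end

theorem lemma3p3:
  fixes \<Omega> :: "(real^2) set"
    and \<T> :: "(real^2) set set"
    and a :: "real^2 \<Rightarrow> real^2^2"
    and f g :: "real^2 \<Rightarrow> real"
    and lam1 lam2 \<sigma> :: real
    and k :: nat
  assumes "polygonal_domain \<Omega>"
    and "triangular_mesh \<Omega> \<T>"
    and "shape_regular \<sigma> \<T>"
    and "k \<ge> 1"
    and "lam1 > 0" and "lam2 > 0"
    and "a \<in> borel_measurable (lebesgue_on \<Omega>)"
    and "\<And>x. x \<in> \<Omega> \<Longrightarrow> transpose (a x) = a x"
    and "\<And>x \<xi>. x \<in> \<Omega> \<Longrightarrow> lam1 * (\<xi> \<bullet> \<xi>) \<le> \<xi> \<bullet> (a x *v \<xi>) \<and> \<xi> \<bullet> (a x *v \<xi>) \<le> lam2 * (\<xi> \<bullet> \<xi>)"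
    and "L2_on \<Omega> f"
    and "L2_on_boundary \<Omega> g"
  shows "\<exists>!u. u \<in> Vh k \<T> \<and>
           (\<forall>e\<in>boundary_edges \<Omega> \<T>. \<forall>x\<in>e. snd u e x = Qb k e g x) \<and>
           (\<forall>v\<in>Vh0 k \<Omega> \<T>.
              (\<Sum>T\<in>\<T>. LINT x|lebesgue_on T. (a x *v weak_gradient k u T x) \<bullet> weak_gradient k v T x) =
              (\<Sum>T\<in>\<T>. LINT x|lebesgue_on T. f x * fst v T x))"
proof -
  interpret wg_problem \<Omega> \<T> a f g lam1 lam2 k
    by standard (use assms in auto)
  have eq: "(\<forall>v\<in>Vh0 k \<Omega> \<T>. energy u v = load v) \<longleftrightarrow>
      (\<forall>v\<in>Vh0 k \<Omega> \<T>.
        (\<Sum>T\<in>\<T>. LINT x|lebesgue_on T. (a x *v weak_gradient k u T x) \<bullet> weak_gradient k v T x) =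
        (\<Sum>T\<in>\<T>. LINT x|lebesgue_on T. f x * fst v T x))" if "u \<in> Vh k \<T>" for u
    using energy_eq[OF that] by (intro ball_cong refl) (simp add: load_def Vh0_def)
  show ?thesis
    \<comment> \<open>\<open>eq\<close> holds only for members of \<open>Vh\<close>;
      \<open>conj_cong\<close> supplies this from the first conjunct.\<close>
    by (rule iffD1[OF arg_cong[where f = Ex1] solution_ex1], intro ext conj_cong refl eq)
qed

end
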